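(* Let $T\colon X\to X$ be a continuous transformation of a nonempty compact metric space, and let $(f_n)_{n\ge1}$ be a subadditive sequence of upper semi-continuous functions $f_n\colon X\to\mathbb{R} \cup \{-\infty\}$. Then \begin{align*} \beta[(f_n)]&=\sup_{\mu \in \mathcal{E}_T} \inf_{n \geq 1}\frac{1}{n}\int f_n\,d\mu = \inf_{n \geq 1}\sup_{x \in X}\frac{1}{n}f_n(x) \\ &= \inf_{n \geq 1}\sup_{\mu \in \mathcal{M}_T}\frac{1}{n}\int f_n\,d\mu = \sup_{x \in X} \inf_{n \geq 1} \frac{1}{n}f_n(x),\end{align*} where $\beta[(f_n)]:= \sup_{\mu \in \mathcal{M}_T}\inf_{n \geq 1} \frac{1}{n}\int f_n\,d\mu$. In all but the last of these expressions, the infimum over all $n\geq 1$ may be replaced with the limit as $n \to \infty$ of the same quantity, without altering the value of the expression. Furthermore, each of the suprema $\sup_{\mu \in \mathcal{M}_T}\inf_{n \geq 1} \frac{1}{n}\int f_n\,d\mu$, $\sup_{\mu \in \mathcal{E}_T} \inf_{n \geq 1}\frac{1}{n}\int f_n\,d\mu$ and $\sup_{x \in X} \inf_{n \geq 1} \frac{1}{n}f_n(x)$ is attained, and for every $n\ge1$ each of the suprema $\sup_{x \in X}\frac{1}{n}f_n(x)$ and $\sup_{\mu \in \mathcal{M}_T}\frac{1}{n}\int f_n\,d\mu$ is attained.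
   Context: A sequence $(f_n)_{n\ge1}$ of functions from $X$ to $\mathbb{R}\cup\{-\infty\}$ is subadditive if $f_{n+m}(x)\le f_n(T^mx)+f_m(x)$ for all $x\in X$ and $n,m\ge1$. $\mathcal{M}_T$ is the set of $T$-invariant Borel probability measures on $X$, and $\mathcal{E}_T\subseteq\mathcal{M}_T$ is the set of those with respect to which $T$ is ergodic. *)

theory Defs
  imports "HOL-Probability.Probability"
begin

definition upper_semicontinuous :: "('a::topological_space \<Rightarrow> ereal) \<Rightarrow> bool" where
  "upper_semicontinuous f \<longleftrightarrow> (\<forall>c. open {x. f x < c})"

text \<open>Only the members of the sequence with positive index are meaningful; \<open>f 0\<close> is arbitrary.\<close>

definition subadditive_sequence :: "('a \<Rightarrow> 'a) \<Rightarrow> (nat \<Rightarrow> 'a \<Rightarrow> ereal) \<Rightarrow> bool" where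
  "subadditive_sequence T f \<longleftrightarrow>
     (\<forall>n\<ge>1. \<forall>m\<ge>1. \<forall>x. f (n + m) x \<le> f n ((T ^^ m) x) + f m x)"

definition invariant_measures :: "('a::topological_space \<Rightarrow> 'a) \<Rightarrow> 'a measure set" where
  "invariant_measures T =
     {\<mu>. prob_space \<mu> \<and> sets \<mu> = sets borel \<and>
         (\<forall>A\<in>sets borel. emeasure \<mu> (T -` A) = emeasure \<mu> A)}"

definition ergodic_measures :: "('a::topological_space \<Rightarrow> 'a) \<Rightarrow> 'a measure set" where
  "ergodic_measures T =
     {\<mu> \<in> invariant_measures T.
        \<forall>A\<in>sets borel. T -` A = A \<longrightarrow> emeasure \<mu> A = 0 \<or> emeasure \<mu> A = 1}"

text \<open>
  The extended Lebesgue integral, i.e. the integral of the positive part minus that of the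
  negative part. Note that \<open>e2ennreal\<close> truncates negative arguments to \<open>0\<close>. The difference
  is the genuine integral unless both parts are infinite; an upper semi-continuous function
  on a compact space without the value \<open>\<infinity>\<close> is bounded above, so that its positive
  part has finite integral with respect to every Borel probability measure.
\<close>

definition ext_integral :: "'a measure \<Rightarrow> ('a \<Rightarrow> ereal) \<Rightarrow> ereal" where
  "ext_integral M f =
     enn2ereal (\<integral>\<^sup>+ x. e2ennreal (f x) \<partial>M) - enn2ereal (\<integral>\<^sup>+ x. e2ennreal (- f x) \<partial>M)"

lemma ext_integral_eq_integral:
  assumes "integrable M g"
  shows "ext_integral M (\<lambda>x. ereal (g x)) = ereal (integral\<^sup>L M g)"
proof -
  have "integrable M (\<lambda>x. - g x)" using assms by simp
  hence "(\<integral>\<^sup>+ x. ennreal (g x) \<partial>M) \<noteq> \<top>" "(\<integral>\<^sup>+ x. ennreal (- g x) \<partial>M) \<noteq> \<top>"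
    using assms unfolding real_integrable_def by (auto simp: infinity_ennreal_def)
  moreover have "enn2ereal y = ereal (enn2real y)" if "y \<noteq> \<top>" for y
    using that by (cases y) (auto simp: enn2ereal_ennreal)
  ultimately show ?thesis
    unfolding ext_integral_def real_lebesgue_integral_def[OF assms] by (simp add: e2ennreal_ereal)
qed

definition max_growth :: "('a::topological_space \<Rightarrow> 'a) \<Rightarrow> (nat \<Rightarrow> 'a \<Rightarrow> ereal) \<Rightarrow> ereal" where
  "max_growth T f =
     (SUP \<mu>\<in>invariant_measures T. INF n\<in>{1..}. ext_integral \<mu> (f n) / ereal (real n))"

end

theory Submission
  imports Defs
begin

text \<open>
  Let \<open>\<gamma>\<close> be the infimum over \<open>n\<close> of the maximum of \<open>f n / n\<close>; it bounds all the other quantities from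
  above. If every point \<open>x\<close> had some \<open>k \<le> N\<close> with \<open>f k x \<le> k (\<gamma> - \<epsilon>)\<close>, cutting orbits into such
  blocks would give \<open>f n \<le> n (\<gamma> - \<epsilon>) + B\<close> for all \<open>n\<close>, a contradiction; hence by compactness there
  is a point \<open>x\<close> with \<open>f n x \<ge> n \<gamma>\<close> for all \<open>n\<close>. The empirical measures along its orbit accumulate at
  an invariant measure \<open>\<mu>\<close> whose integrals satisfy \<open>\<integral> f n d\<mu> \<ge> n \<gamma>\<close>. The invariant measures with this
  property form a nonempty weakly closed face, and maximising a strictly convex functional on it
  yields an ergodic one.

  Weak sequential compactness of the probability measures is pulled back from Helly's theorem on
  the line: the ternary code of a point with respect to a countable base is a Borel injection into
  the reals, and its inverse extends to a continuous map on a compact set of reals.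
\<close>

section \<open>Countable bases and a ternary code for compact metric spaces\<close>

text \<open>The delicate point is that the maximising measures form a face. For one fixed
  \<open>n\<close> nothing prevents one half of an invariant splitting from having an integral of
  \<open>f n\<close> far above \<open>n \<gamma>\<close> and so hiding a deficit in the other half.
  Asymptotically this is impossible, since the maximum of \<open>f n / n\<close> tends to \<gamma>;
  Fekete's lemma, by which a growth rate is an infimum over \<open>n\<close>, carries the asymptotic
  bound back to each \<open>n\<close>. Weak convergence tests only continuous functions, while
  \<open>f n\<close> is merely upper semi-continuous and may take the value -\<infinity>. It is
  therefore written as a decreasing limit of real continuous functions, and its integral as a
  constant minus one nonnegative integral, so that inequalities pass to weak limits in the one
  direction required. If \<gamma> is -\<infinity>, the lower bounds hold for every point and
  measure, and only the existence of some ergodic measure is left.\<close>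

lemma compact_metric_countable_basis:
  assumes "compact (UNIV :: 'a::metric_space set)"
  shows "\<exists>B :: nat \<Rightarrow> 'a set. topological_basis (range B) \<and> (\<forall>i j. \<exists>k. B i \<inter> B j = B k)"
proof -
  have "\<forall>n. \<exists>K::'a set. finite K \<and> UNIV \<subseteq> (\<Union>x\<in>K. ball x (1 / Suc n))"
    using assms unfolding compact_eq_totally_bounded by (metis divide_pos_pos of_nat_0_less_iff zero_less_Suc zero_less_one)
  then obtain K :: "nat \<Rightarrow> 'a set" where K: "\<And>n. finite (K n)" "\<And>n. UNIV \<subseteq> (\<Union>x\<in>K n. ball x (1 / Suc n))"
    by metis
  define \<B> where "\<B> = (\<Union>n. (\<lambda>x. ball x (1 / Suc n)) ` K n)"
  have cB: "countable \<B>" unfolding \<B>_def by (intro countable_UN) (auto intro: countable_finite K(1))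
  have "topological_basis \<B>"
  proof (rule topological_basisI)
    show "open B" if "B \<in> \<B>" for B using that by (auto simp: \<B>_def)
    fix U :: "'a set" and x assume "open U" "x \<in> U"
    then obtain e where e: "e > 0" "ball x e \<subseteq> U" using open_contains_ball by blast
    obtain n where n: "inverse (real (Suc n)) < e / 2" using reals_Archimedean[of "e/2"] e by auto
    obtain d where d: "d \<in> K n" "x \<in> ball d (1 / Suc n)" using K(2)[of n] by blast
    have "ball d (1 / Suc n) \<subseteq> ball x e"
    proof
      fix y assume "y \<in> ball d (1 / Suc n)"
      then have "dist x y < 2 * (1 / Suc n)" using d(2) dist_triangle[of x y d] by (simp add: dist_commute)
      then show "y \<in> ball x e" using n by (auto simp: inverse_eq_divide)
    qed
    then show "\<exists>B\<in>\<B>. x \<in> B \<and> B \<subseteq> U" using d e by (auto simp: \<B>_def)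
  qed
  \<comment> \<open>Closing under finite intersections turns the base into an intersection-stable
    generator of the Borel sets, as uniqueness of measures requires. The empty intersection
    contributes \<open>UNIV\<close>, so \<C> is nonempty.\<close>
  define \<C> where "\<C> = Inter ` {F. finite F \<and> F \<subseteq> \<B>}"
  have cC: "countable \<C>" unfolding \<C>_def by (intro countable_image countable_Collect_finite_subset cB)
  have neC: "\<C> \<noteq> {}" unfolding \<C>_def by auto
  have sub: "\<B> \<subseteq> \<C>" unfolding \<C>_def by (auto intro!: image_eqI[of _ _ "{_}"])
  have opC: "open U" if "U \<in> \<C>" for U
    using that \<open>topological_basis \<B>\<close> unfolding \<C>_def by (auto intro!: open_Inter dest: topological_basis_open)
  have bas: "topological_basis \<C>"
  proof (rule topological_basisI)
    show "\<exists>W\<in>\<C>. x \<in> W \<and> W \<subseteq> U" if "open U" "x \<in> U" for U x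
      using topological_basisE[OF \<open>topological_basis \<B>\<close> that] sub by (metis subsetD)
  qed (rule opC)
  have int: "U \<inter> V \<in> \<C>" if UV: "U \<in> \<C>" "V \<in> \<C>" for U V
  proof -
    obtain F G where "finite F" "F \<subseteq> \<B>" "U = \<Inter>F" "finite G" "G \<subseteq> \<B>" "V = \<Inter>G"
      using UV unfolding \<C>_def by blast
    then have "U \<inter> V = \<Inter>(F \<union> G)" "finite (F \<union> G)" "F \<union> G \<subseteq> \<B>"
      by (simp_all add: Inter_Un_distrib)
    then show ?thesis unfolding \<C>_def by (intro image_eqI CollectI conjI)
  qed
  have r: "range (from_nat_into \<C>) = \<C>" by (rule range_from_nat_into[OF neC cC])
  show ?thesis
  proof (intro exI[of _ "from_nat_into \<C>"] conjI allI)
    show "topological_basis (range (from_nat_into \<C>))" using r bas by simp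
    fix i j
    have "from_nat_into \<C> i \<inter> from_nat_into \<C> j \<in> range (from_nat_into \<C>)"
      unfolding r by (intro int from_nat_into neC)
    then show "\<exists>k. from_nat_into \<C> i \<inter> from_nat_into \<C> j = from_nat_into \<C> k"
      by (elim rangeE) (rule exI)
  qed
qed

text \<open>The whole space is a separate case because \<open>infdist\<close> to the empty set is 0
  by convention, which would give the zero function instead of the indicator.\<close>

definition bump :: "'a::metric_space set \<Rightarrow> nat \<Rightarrow> 'a \<Rightarrow> real" where
  "bump U j x = (if U = UNIV then 1 else min 1 (real j * infdist x (- U)))"

lemma bump_bounds: "0 \<le> bump U j x" "bump U j x \<le> 1"
  by (auto simp: bump_def infdist_nonneg)

lemma continuous_bump: "continuous_on UNIV (bump U j)"
  unfolding bump_def by (cases "U = UNIV") (auto intro!: continuous_intros)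

lemma bump_tendsto:
  assumes "open U"
  shows "(\<lambda>j. bump U j x) \<longlonglongrightarrow> indicator U x"
proof (cases "U = UNIV")
  case True then show ?thesis by (simp add: bump_def)
next
  case False
  then have ne: "- U \<noteq> {}" by auto
  have cl: "closed (- U)" using assms by auto
  show ?thesis
  proof (cases "x \<in> U")
    case True
    then have pos: "infdist x (- U) > 0" using infdist_pos_not_in_closed[OF cl ne, of x] by auto
    obtain N :: nat where N: "real N > 1 / infdist x (- U)" using reals_Archimedean2 by blast
    have "bump U j x = 1" if "j \<ge> N" for j
    proof -
      have "real j \<ge> 1 / infdist x (- U)" using N that by linarith
      then have "real j * infdist x (- U) \<ge> 1" using pos by (simp add: field_simps)
      then show ?thesis by (simp add: bump_def min_def)
    qed
    then have "eventually (\<lambda>j. bump U j x = 1) sequentially" by (auto simp: eventually_sequentially)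
    then show ?thesis using True by (simp add: tendsto_eventually)
  next
    case F: False
    then have "bump U j x = 0" for j using False by (simp add: bump_def)
    then show ?thesis using F by simp
  qed
qed

lemma integrable_continuous_compact:
  fixes g :: "'a::topological_space \<Rightarrow> real"
  assumes "compact (UNIV :: 'a set)" "finite_measure M" "sets M = sets borel" "continuous_on UNIV g"
  shows "integrable M g"
proof -
  interpret finite_measure M by fact
  have "compact (range g)" using assms by (intro compact_continuous_image)
  then obtain b where "\<And>x. norm (g x) \<le> b" using compact_imp_bounded bounded_iff by (metis rangeI)
  moreover have "g \<in> borel_measurable M"
    using borel_measurable_continuous_onI[OF assms(4)] assms(3) measurable_cong_sets by blast
  ultimately show ?thesis by (intro integrable_const_bound[where B=b]) auto
qed

text \<open>The space of measures is treated sequentially, with weak convergence tested on all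
  continuous functions; on a compact space these are bounded.\<close>

definition weakly_converges :: "(nat \<Rightarrow> 'a::topological_space measure) \<Rightarrow> 'a measure \<Rightarrow> bool" where
  "weakly_converges \<mu>s \<mu> \<longleftrightarrow>
     (\<forall>g::'a \<Rightarrow> real. continuous_on UNIV g \<longrightarrow> (\<lambda>n. \<integral>x. g x \<partial>\<mu>s n) \<longlonglongrightarrow> (\<integral>x. g x \<partial>\<mu>))"

definition borel_probs :: "'a::topological_space measure set" where
  "borel_probs = {\<mu>. prob_space \<mu> \<and> sets \<mu> = sets borel}"

lemma bump_integral_tendsto:
  assumes "compact (UNIV :: 'a::metric_space set)" "\<mu> \<in> borel_probs" "open (U :: 'a set)"
  shows "(\<lambda>j. \<integral>x. bump U j x \<partial>\<mu>) \<longlonglongrightarrow> measure \<mu> U"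
proof -
  interpret prob_space \<mu> using assms by (auto simp: borel_probs_def)
  have s: "sets \<mu> = sets borel" using assms by (auto simp: borel_probs_def)
  have U: "U \<in> sets \<mu>" using s assms by auto
  have "(\<lambda>j. \<integral>x. bump U j x \<partial>\<mu>) \<longlonglongrightarrow> (\<integral>x. indicator U x \<partial>\<mu>)"
  proof (rule integral_dominated_convergence[where w="\<lambda>_. 1"])
    show "(indicator U :: 'a \<Rightarrow> real) \<in> borel_measurable \<mu>" using U by simp
    show "bump U j \<in> borel_measurable \<mu>" for j
      using borel_measurable_continuous_onI[OF continuous_bump] s measurable_cong_sets by blast
  qed (use bump_tendsto[OF assms(3)] in \<open>auto simp: bump_bounds\<close>)
  then show ?thesis using U by simp
qed

text \<open>The bumps recover the measure of each basic set in the limit, and the basic sets form an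
  intersection-stable generator. The test functions are countable in number, which later allows all
  their integrals to enter a single convergent series.\<close>

lemma borel_probs_eqI:
  fixes B :: "nat \<Rightarrow> 'a::metric_space set"
  assumes c: "compact (UNIV :: 'a set)" and m: "\<mu> \<in> borel_probs" "\<nu> \<in> borel_probs"
    and B: "topological_basis (range B)" "\<And>i j. \<exists>k. B i \<inter> B j = B k"
    and eq: "\<And>i j. (\<integral>x. bump (B i) j x \<partial>\<mu>) = (\<integral>x. bump (B i) j x \<partial>\<nu>)"
  shows "\<mu> = \<nu>"
proof -
  interpret M: prob_space \<mu> using m by (auto simp: borel_probs_def)
  interpret N: prob_space \<nu> using m by (auto simp: borel_probs_def)
  have s: "sets \<mu> = sets borel" "sets \<nu> = sets borel" using m by (auto simp: borel_probs_def)
  have sp: "space \<mu> = UNIV" "space \<nu> = UNIV" using s by (auto dest: sets_eq_imp_space_eq)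
  have op: "open (B i)" for i using B(1) by (auto dest: topological_basis_open)
  have e1: "measure \<mu> (B i) = measure \<nu> (B i)" for i
    using bump_integral_tendsto[OF c m(1) op] bump_integral_tendsto[OF c m(2) op] eq
      LIMSEQ_unique by (metis (no_types, lifting) ext)
  have b: "sets borel = sigma_sets UNIV (range B)"
  proof -
    have "borel = sigma UNIV (range B)" by (intro borel_eq_countable_basis countable_image countableI_type B(1))
    then have "sets borel = sets (sigma UNIV (range B))" by (rule arg_cong)
    then show ?thesis by simp
  qed
  \<comment> \<open>\<open>UNIV\<close> joins the generator so that the constant sequence
    \<open>UNIV\<close> can serve as the cover by sets of finite measure.\<close>
  show ?thesis
  proof (rule measure_eqI_generator_eq[of "insert UNIV (range B)" UNIV _ _ "\<lambda>_. UNIV"])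
    show "Int_stable (insert UNIV (range B))"
    proof (rule Int_stableI)
      fix U V assume "U \<in> insert UNIV (range B)" "V \<in> insert UNIV (range B)"
      then consider "U = UNIV" | "V = UNIV" | i j where "U = B i" "V = B j" by blast
      then show "U \<inter> V \<in> insert UNIV (range B)"
      proof cases
        case 3
        then show ?thesis using B(2)[of i j] by auto
      qed (use \<open>U \<in> _\<close> \<open>V \<in> _\<close> in auto)
    qed
    have "sigma_sets UNIV (insert UNIV (range B)) = sigma_sets UNIV (range B)"
      by (rule sigma_sets_eqI) (auto intro: sigma_sets_top)
    then show "sets \<mu> = sigma_sets UNIV (insert UNIV (range B))" "sets \<nu> = sigma_sets UNIV (insert UNIV (range B))"
      using s b by auto
    show "emeasure \<mu> X = emeasure \<nu> X" if "X \<in> insert UNIV (range B)" for X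
    proof (cases "X = UNIV")
      case True then show ?thesis using M.emeasure_space_1 N.emeasure_space_1 sp by simp
    next
      case False
      then show ?thesis using that e1 by (auto simp: M.emeasure_eq_measure N.emeasure_eq_measure)
    qed
  qed (auto simp: M.emeasure_eq_measure)
qed

text \<open>Base-3 digits \<open>0\<close> and \<open>2\<close>, as for the Cantor set.\<close>

definition ternary_code :: "(nat \<Rightarrow> 'a set) \<Rightarrow> 'a \<Rightarrow> real" where
  "ternary_code B x = (\<Sum>i. 2 * indicator (B i) x / 3 ^ Suc i)"

lemma ternary_tail: "(\<lambda>i. 2 / 3 ^ Suc i :: real) sums 1"
  using sums_mult[OF geometric_sums[of "1/3::real"], of "2/3"] by (simp add: field_simps)

lemma ternary_summable: "summable (\<lambda>i. 2 * indicator (B i) x / 3 ^ Suc i :: real)"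
  by (rule summable_comparison_test'[OF sums_summable[OF ternary_tail], of 0]) (auto simp: indicator_def)

lemma ternary_code_bounds: "0 \<le> ternary_code B x" "ternary_code B x \<le> 1"
proof -
  show "0 \<le> ternary_code B x" unfolding ternary_code_def by (intro suminf_nonneg ternary_summable) auto
  have "ternary_code B x \<le> (\<Sum>i. 2 / 3 ^ Suc i)" unfolding ternary_code_def
    by (intro suminf_le ternary_summable sums_summable[OF ternary_tail]) (auto simp: indicator_def)
  then show "ternary_code B x \<le> 1" using sums_unique[OF ternary_tail] by simp
qed

lemma ternary_code_step:
  "3 * ternary_code B x = 2 * indicator (B 0) x + ternary_code (\<lambda>i. B (Suc i)) x"
proof -
  let ?a = "\<lambda>i. 2 * indicator (B i) x / 3 ^ Suc i :: real"
  have "ternary_code B x = ?a 0 + (\<Sum>i. ?a (Suc i))"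
    unfolding ternary_code_def using suminf_split_head[OF ternary_summable[of B x]] by simp
  moreover have "(\<Sum>i. ?a (Suc i)) = ternary_code (\<lambda>i. B (Suc i)) x / 3"
    unfolding ternary_code_def by (subst suminf_divide[symmetric]) (use ternary_summable[of "\<lambda>i. B (Suc i)" x] in auto)
  ultimately show ?thesis by simp
qed

text \<open>Tripling the code shifts its digits. At the first differing digit the tripled codes
  differ by 2 up to tails in [0,1], so a gap of at least 1 survives. Binary digits would leave no
  gap, as two expansions can denote the same number.\<close>

lemma ternary_code_separates:
  "(x \<in> B i) \<noteq> (y \<in> B i) \<Longrightarrow> (1 / 3) ^ Suc i \<le> \<bar>ternary_code B x - ternary_code B y\<bar>"
proof (induction i arbitrary: B)
  case 0
  note b = ternary_code_bounds[of "\<lambda>i. B (Suc i)"]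
  show ?case using 0 ternary_code_step[of B x] ternary_code_step[of B y] b[of x] b[of y]
    by (auto simp: indicator_def)
next
  case (Suc i)
  note b = ternary_code_bounds[of "\<lambda>i. B (Suc i)"]
  have IH: "(1 / 3) ^ Suc i \<le> \<bar>ternary_code (\<lambda>i. B (Suc i)) x - ternary_code (\<lambda>i. B (Suc i)) y\<bar>"
    using Suc by auto
  show ?case
  proof (cases "(x \<in> B 0) = (y \<in> B 0)")
    case True
    then have "3 * (ternary_code B x - ternary_code B y) =
       ternary_code (\<lambda>i. B (Suc i)) x - ternary_code (\<lambda>i. B (Suc i)) y"
      using ternary_code_step[of B x] ternary_code_step[of B y] by (simp add: indicator_def)
    then have "3 * \<bar>ternary_code B x - ternary_code B y\<bar> =
       \<bar>ternary_code (\<lambda>i. B (Suc i)) x - ternary_code (\<lambda>i. B (Suc i)) y\<bar>"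
      by (metis abs_mult abs_numeral)
    then show ?thesis using IH by simp
  next
    case False
    then have "1/3 \<le> \<bar>ternary_code B x - ternary_code B y\<bar>"
      using ternary_code_step[of B x] ternary_code_step[of B y] b[of x] b[of y]
      by (auto simp: indicator_def)
    moreover have "(1 / 3 :: real) ^ Suc (Suc i) \<le> 1 / 3"
      using power_decreasing[of 1 "Suc (Suc i)" "1 / 3 :: real"] by simp
    ultimately show ?thesis by linarith
  qed
qed

lemma ternary_code_measurable:
  assumes "\<And>i. B i \<in> sets M"
  shows "ternary_code B \<in> borel_measurable M"
  unfolding ternary_code_def using assms by measurable

text \<open>The code is only Borel, but its inverse is continuous, and even extends to limits of
  codes. The closure of the graph is compact, and its first projection is injective: over a common
  first coordinate, two distinct second coordinates would be separated by some basic set, and the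
  codes of approximating points would stay apart. Hence that projection is a homeomorphism onto a
  compact set \<open>C\<close>, and \<pi> is its inverse followed by \<open>snd\<close>.\<close>

lemma ternary_code_inverse:
  assumes c: "compact (UNIV :: 'a::metric_space set)" and B: "topological_basis (range (B :: nat \<Rightarrow> 'a set))"
  shows "\<exists>C \<pi>. compact C \<and> range (ternary_code B) \<subseteq> C \<and> continuous_on C \<pi> \<and> (\<forall>x. \<pi> (ternary_code B x) = x)"
proof -
  define s where "s = ternary_code B"
  define K where "K = closure (range (\<lambda>x. (s x, x)))"
  have "K \<subseteq> {0..1} \<times> UNIV" unfolding K_def
    by (rule closure_minimal) (auto simp: s_def ternary_code_bounds closed_Times)
  moreover have "compact ({0..1::real} \<times> (UNIV :: 'a set))" using c by (intro compact_Times) auto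
  ultimately have K: "compact K" by (metis K_def closed_closure compact_Int_closed inf.absorb2)
  have op: "open (B i)" for i using B by (auto dest: topological_basis_open)
  have "inj_on fst K"
  proof (rule inj_onI)
    fix p q assume p: "p \<in> K" and q: "q \<in> K" and e: "fst p = fst q"
    obtain u where u: "\<And>n. u n \<in> range (\<lambda>x. (s x, x))" "u \<longlonglongrightarrow> p"
      using p unfolding K_def closure_sequential by auto
    obtain v where v: "\<And>n. v n \<in> range (\<lambda>x. (s x, x))" "v \<longlonglongrightarrow> q"
      using q unfolding K_def closure_sequential by auto
    define x y where "x n = snd (u n)" and "y n = snd (v n)" for n
    have x: "s (x n) = fst (u n)" and y: "s (y n) = fst (v n)" for n
      using u(1)[of n] v(1)[of n] by (auto simp: x_def y_def)
    have lx: "x \<longlonglongrightarrow> snd p" "(\<lambda>n. s (x n)) \<longlonglongrightarrow> fst p"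
      unfolding x using tendsto_snd[OF u(2)] tendsto_fst[OF u(2)] by (simp_all add: x_def[abs_def])
    have ly: "y \<longlonglongrightarrow> snd q" "(\<lambda>n. s (y n)) \<longlonglongrightarrow> fst p"
      unfolding y e using tendsto_snd[OF v(2)] tendsto_fst[OF v(2)] by (simp_all add: y_def[abs_def])
    have "snd p = snd q"
    proof (rule ccontr)
      assume "snd p \<noteq> snd q"
      then obtain U V where UV: "open U" "open V" "snd p \<in> U" "snd q \<in> V" "U \<inter> V = {}"
        using hausdorff[of "snd p" "snd q"] by metis
      obtain i where i: "snd p \<in> B i" "B i \<subseteq> U" using topological_basisE[OF B UV(1,3)] by auto
      have "eventually (\<lambda>n. x n \<in> B i) sequentially" using topological_tendstoD[OF lx(1) op i(1)] .
      moreover have "eventually (\<lambda>n. y n \<in> V) sequentially" using topological_tendstoD[OF ly(1) UV(2) UV(4)] .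
      moreover have "(\<lambda>n. s (x n) - s (y n)) \<longlonglongrightarrow> 0" using tendsto_diff[OF lx(2) ly(2)] by simp
      then have "eventually (\<lambda>n. dist (s (x n) - s (y n)) 0 < (1/3) ^ Suc i) sequentially"
        by (rule tendstoD) simp
      ultimately have "eventually (\<lambda>n. False) sequentially"
      proof eventually_elim
        case (elim n)
        then have "(x n \<in> B i) \<noteq> (y n \<in> B i)" using i UV by auto
        from ternary_code_separates[of "x n" B i "y n", OF this] elim(3) show ?case by (simp add: s_def)
      qed
      then show False by simp
    qed
    then show "p = q" using e by (simp add: prod_eq_iff)
  qed
  then obtain g where g: "homeomorphism K (fst ` K) fst g"
    using homeomorphism_compact[OF K, of fst] continuous_on_fst[OF continuous_on_id] by (metis)
  have mem: "(s x, x) \<in> K" for x unfolding K_def using closure_subset by fast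
  have "compact (fst ` K)" using K by (intro compact_continuous_image continuous_intros)
  moreover have "range s \<subseteq> fst ` K" using mem by force
  moreover have "continuous_on (fst ` K) (snd \<circ> g)"
    using homeomorphism_cont2[OF g] by (intro continuous_on_compose continuous_intros) auto
  moreover have "(snd \<circ> g) (s x) = x" for x using homeomorphism_apply1[OF g mem[of x]] by simp
  ultimately show ?thesis unfolding s_def by blast
qed

section \<open>Sequential compactness of the space of probability measures\<close>

lemma borel_probs_seq_compact:
  fixes \<mu>s :: "nat \<Rightarrow> 'a::metric_space measure"
  assumes c: "compact (UNIV :: 'a set)" and \<mu>s: "\<And>n. \<mu>s n \<in> borel_probs"
  shows "\<exists>r \<mu>. strict_mono r \<and> \<mu> \<in> borel_probs \<and> weakly_converges (\<mu>s \<circ> r) \<mu>"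
proof -
  have ps: "prob_space (\<mu>s n)" and s\<mu>: "sets (\<mu>s n) = sets borel" for n using \<mu>s by (auto simp: borel_probs_def)
  obtain B :: "nat \<Rightarrow> 'a set" where B: "topological_basis (range B)"
    using compact_metric_countable_basis[OF c] by blast
  obtain C \<pi> where C: "compact C" "range (ternary_code B) \<subseteq> C" "continuous_on C \<pi>"
    and \<pi>: "\<And>x. \<pi> (ternary_code B x) = x"
    using ternary_code_inverse[OF c B] by blast
  define s where "s = ternary_code B"
  have op: "open (B i)" for i using B by (auto dest: topological_basis_open)
  have sm: "s \<in> borel_measurable (\<mu>s n)" for n
    unfolding s_def by (rule ternary_code_measurable) (simp add: s\<mu> op)
  define \<nu> where "\<nu> n = distr (\<mu>s n) borel s" for n
  have rd: "real_distribution (\<nu> n)" for n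
    unfolding \<nu>_def using prob_space.real_distribution_distr[OF ps sm] .
  \<comment> \<open>Codes lie in [0,1], so one interval carries all the mass; being open on the
    left, it has to start below 0.\<close>
  have "tight \<nu>"
    unfolding tight_def
  proof (intro conjI allI impI)
    fix e :: real assume e: "e > 0"
    have "measure (\<nu> n) {-1<..1} = 1" for n
    proof -
      have "measure (\<nu> n) {-1<..1} = measure (\<mu>s n) (s -` {-1<..1} \<inter> space (\<mu>s n))"
        unfolding \<nu>_def by (rule measure_distr[OF sm]) simp
      also have "s -` {-1<..1} = UNIV"
      proof -
        have "s x \<in> {-1<..1}" for x using ternary_code_bounds[of B x] by (simp add: s_def)
        then show ?thesis by blast
      qed
      finally show ?thesis using prob_space.prob_space[OF ps] by simp
    qed
    then show "\<exists>a b::real. a < b \<and> (\<forall>n. measure (\<nu> n) {a<..b} > 1 - e)"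
      using e by (intro exI[of _ "-1"] exI[of _ 1]) auto
  qed (rule rd)
  then obtain r M where r: "strict_mono (r :: nat \<Rightarrow> nat)" and M: "real_distribution M"
    and wc: "weak_conv_m (\<nu> \<circ> id \<circ> r) M"
    using tight_imp_convergent_subsubsequence[of \<nu> id] by (auto simp: strict_mono_id)
  interpret M: real_distribution M by fact
  have int_s: "(\<integral>t. G t \<partial>\<nu> n) = (\<integral>x. G (s x) \<partial>\<mu>s n)" if "continuous_on UNIV (G :: real \<Rightarrow> real)" for G n
    unfolding \<nu>_def using borel_measurable_continuous_onI[OF that] by (intro integral_distr sm)
  have lim: "(\<lambda>n. \<integral>x. G (s x) \<partial>\<mu>s (r n)) \<longlonglongrightarrow> (\<integral>t. G t \<partial>M)"
    if G: "continuous_on UNIV G" and b: "\<And>t. norm (G t) \<le> b" for G :: "real \<Rightarrow> real" and b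
  proof -
    have "(\<lambda>n. \<integral>t. G t \<partial>(\<nu> \<circ> id \<circ> r) n) \<longlonglongrightarrow> (\<integral>t. G t \<partial>M)"
      by (rule weak_conv_imp_integral_bdd_continuous_conv[OF _ M wc _ b])
         (use rd G in \<open>auto simp: continuous_on_eq_continuous_at\<close>)
    then show ?thesis using int_s[OF G] by simp
  qed
  have Ccl: "closed C" using C(1) compact_imp_closed by blast
  have sC: "s x \<in> C" for x using C(2) by (auto simp: s_def)
  then have Cne: "C \<noteq> {}" by auto
  \<comment> \<open>The truncated distance to \<open>C\<close> is bounded, continuous and zero at
    every code, so its integral against the limit vanishes: the limit lives on \<open>C\<close>,
    where \<pi> is controlled.\<close>
  have "AE t in M. min 1 (infdist t C) = 0"
  proof -
    let ?h = "\<lambda>t. min 1 (infdist t C)"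
    have h: "continuous_on UNIV ?h" by (intro continuous_intros)
    have "(\<lambda>n. \<integral>x. ?h (s x) \<partial>\<mu>s (r n)) \<longlonglongrightarrow> (\<integral>t. ?h t \<partial>M)"
      by (rule lim[OF h, of 1]) (auto simp: infdist_nonneg)
    moreover have "?h (s x) = 0" for x using sC by simp
    ultimately have "(\<integral>t. ?h t \<partial>M) = 0" by (simp add: LIMSEQ_const_iff)
    moreover have "integrable M ?h"
      by (rule M.integrable_const_bound[where B=1])
         (use borel_measurable_continuous_onI[OF h] in \<open>auto simp: infdist_nonneg\<close>)
    ultimately show ?thesis
      by (subst integral_nonneg_eq_0_iff_AE[symmetric]) (auto simp: infdist_nonneg)
  qed
  then have AEC: "AE t in M. t \<in> C"
    by eventually_elim
       (use in_closed_iff_infdist_zero[OF Ccl Cne] in \<open>auto simp: min_def split: if_splits\<close>)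
  \<comment> \<open>A constant value off the closed set \<open>C\<close> makes the map Borel on the
    whole line, and is seen only by an \<open>M\<close>-null set.\<close>
  define p where "p t = (if t \<in> C then \<pi> t else undefined)" for t
  have pm: "p \<in> borel_measurable M"
  proof -
    have "p \<in> borel_measurable borel" unfolding p_def
      by (intro borel_measurable_continuous_on_if C continuous_on_const) (simp add: Ccl)
    then show ?thesis by simp
  qed
  define \<mu> where "\<mu> = distr M borel p"
  have "\<mu> \<in> borel_probs" unfolding borel_probs_def \<mu>_def using M.prob_space_distr[OF pm] by simp
  moreover have "weakly_converges (\<mu>s \<circ> r) \<mu>"
    unfolding weakly_converges_def
  proof (intro allI impI)
    fix g :: "'a \<Rightarrow> real" assume g: "continuous_on UNIV g"
    have "bounded (range g)" using c g by (intro compact_imp_bounded compact_continuous_image)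
    then obtain b where b: "\<And>x. norm (g x) \<le> b" by (auto simp: bounded_iff)
    have b0: "b \<ge> 0" using order_trans[OF norm_ge_zero b] .
    have cg: "continuous_on C (g \<circ> \<pi>)"
      using C(3) g by (intro continuous_on_compose) (auto intro: continuous_on_subset)
    have clC: "closedin (top_of_set UNIV) C" using Ccl by simp
    \<comment> \<open>Weak convergence on the line is tested by functions on all of it, but
      \<open>g \<circ> \<pi>\<close> is continuous only on \<open>C\<close>. Tietze's extension
      keeps the bound \<open>b\<close> and still returns \<open>g\<close> along codes.\<close>
    obtain G where G: "continuous_on UNIV G" "\<And>t. t \<in> C \<Longrightarrow> G t = (g \<circ> \<pi>) t"
      "\<And>t. t \<in> UNIV \<Longrightarrow> norm (G t) \<le> b"
      by (rule Tietze[OF cg clC b0]) (use b in auto)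
    have "G (s x) = g x" for x using G(2)[OF sC] \<pi> by (simp add: s_def)
    then have "(\<lambda>n. \<integral>x. g x \<partial>\<mu>s (r n)) \<longlonglongrightarrow> (\<integral>t. G t \<partial>M)" using lim[OF G(1) G(3)[OF UNIV_I]] by simp
    moreover have "(\<integral>t. G t \<partial>M) = (\<integral>x. g x \<partial>\<mu>)"
    proof -
      have gm: "g \<in> borel_measurable borel" using g by (rule borel_measurable_continuous_onI)
      have "(\<integral>x. g x \<partial>\<mu>) = (\<integral>t. g (p t) \<partial>M)" unfolding \<mu>_def by (rule integral_distr[OF pm gm])
      also have "\<dots> = (\<integral>t. G t \<partial>M)"
      proof (rule integral_cong_AE)
        show "(\<lambda>t. g (p t)) \<in> borel_measurable M" using measurable_compose[OF pm gm] .
        show "G \<in> borel_measurable M" using borel_measurable_continuous_onI[OF G(1)] by simp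
        show "AE t in M. g (p t) = G t" using AEC by eventually_elim (simp add: p_def G(2))
      qed
      finally show ?thesis by simp
    qed
    ultimately show "(\<lambda>n. \<integral>x. g x \<partial>(\<mu>s \<circ> r) n) \<longlonglongrightarrow> (\<integral>x. g x \<partial>\<mu>)" by simp
  qed
  ultimately show ?thesis using r by blast
qed

section \<open>Growth of subadditive sequences\<close>

lemma finite_ereal_bound:
  fixes a :: "'b \<Rightarrow> ereal"
  assumes "finite A" "\<And>k. k \<in> A \<Longrightarrow> a k \<noteq> \<infinity>"
  shows "\<exists>D. \<forall>k\<in>A. a k \<le> ereal D"
  using assms
proof (induction A rule: finite_induct)
  case (insert k A)
  then obtain D where D: "\<forall>k\<in>A. a k \<le> ereal D" by auto
  have "a k \<le> ereal (real_of_ereal (a k))" using insert.prems[of k] by (cases "a k") auto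
  then have "\<forall>j\<in>insert k A. a j \<le> ereal (max D (real_of_ereal (a k)))"
    using D by (auto intro: order_trans)
  then show ?case by blast
qed auto

text \<open>Blocks are cut from the start of the orbit, with a length depending on the current
  point. Cutting stops once at most \<open>N\<close> steps remain, so the remainder costs a constant
  independent of \<open>M\<close> and \<open>x\<close>, and \<open>M - k\<close> is positive at
  every cut, as subadditivity demands.\<close>

lemma subadditive_linear_bound:
  assumes sub: "subadditive_sequence T f"
    and bd: "\<And>k x. 1 \<le> k \<Longrightarrow> k \<le> N \<Longrightarrow> f k x \<le> ereal D"
    and step: "\<And>x. \<exists>k. 1 \<le> k \<and> k \<le> N \<and> f k x \<le> ereal (real k * c)"
  shows "\<exists>B. \<forall>M\<ge>1. \<forall>x. f M x \<le> ereal (real M * c + B)"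
proof (intro exI allI impI)
  \<comment> \<open>For the remainder, of length at most \<open>N\<close>,
    \<open>\<bar>D\<bar>\<close> bounds its value and \<open>real N * \<bar>c\<bar>\<close> offsets
    the linear term, which may have either sign.\<close>
  define B where "B = \<bar>D\<bar> + real N * \<bar>c\<bar>"
  fix M :: nat and x assume "M \<ge> 1"
  then show "f M x \<le> ereal (real M * c + B)"
  proof (induction M arbitrary: x rule: less_induct)
    case (less M)
    show ?case
    proof (cases "M \<le> N")
      case True
      have "\<bar>real M * c\<bar> \<le> real N * \<bar>c\<bar>" using True by (simp add: abs_mult mult_right_mono)
      then have "D \<le> real M * c + B" unfolding B_def by linarith
      then show ?thesis using bd[of M x] less.prems True order_trans by fastforce
    next
      case False
      obtain k where k: "1 \<le> k" "k \<le> N" "f k x \<le> ereal (real k * c)" using step by blast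
      have "f M x \<le> f (M - k) ((T ^^ k) x) + f k x"
      proof -
        have "f ((M - k) + k) x \<le> f (M - k) ((T ^^ k) x) + f k x"
          using sub[unfolded subadditive_sequence_def, rule_format, of "M - k" k x] k False by simp
        moreover have "M - k + k = M" using k False by simp
        ultimately show ?thesis by simp
      qed
      also have "\<dots> \<le> ereal (real (M - k) * c + B) + ereal (real k * c)"
        using k False by (intro add_mono less.IH) auto
      also have "\<dots> = ereal (real M * c + B)" using k False by (simp add: of_nat_diff algebra_simps)
      finally show ?thesis .
    qed
  qed
qed

lemma ereal_div_nat_le_iff:
  assumes "n \<ge> 1"
  shows "x / ereal (real n) \<le> ereal c \<longleftrightarrow> x \<le> ereal (real n * c)"
  using assms by (cases x) (auto simp: field_simps)

lemma ereal_le_div_nat_iff: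
  assumes "n \<ge> 1"
  shows "ereal c \<le> x / ereal (real n) \<longleftrightarrow> ereal (real n * c) \<le> x"
  using assms by (cases x) (auto simp: field_simps)

text \<open>Fekete's lemma, with -\<infinity> allowed as a term and as the limit. A bound
  \<open>c\<close> above \<open>a k / k\<close> for a single \<open>k\<close> spreads through blocks
  of constant length \<open>k\<close> with an error \<open>B / n\<close>, which the gap between
  \<open>c\<close> and \<open>d\<close> absorbs.\<close>

lemma ereal_subadditive_tendsto:
  fixes a :: "nat \<Rightarrow> ereal"
  assumes sub: "\<And>n m. 1 \<le> n \<Longrightarrow> 1 \<le> m \<Longrightarrow> a (n + m) \<le> a n + a m"
    and fin: "\<And>n. 1 \<le> n \<Longrightarrow> a n \<noteq> \<infinity>"
  shows "(\<lambda>n. a n / ereal (real n)) \<longlonglongrightarrow> (INF n\<in>{1..}. a n / ereal (real n))"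
proof (rule order_tendstoI)
  let ?L = "INF n\<in>{1..}. a n / ereal (real n)"
  have "eventually (\<lambda>n. ?L \<le> a n / ereal (real n)) sequentially"
    using eventually_ge_at_top[of 1] by eventually_elim (auto intro: INF_lower)
  then show "eventually (\<lambda>n. y < a n / ereal (real n)) sequentially" if "y < ?L" for y
    by eventually_elim (use that in auto)
  fix y assume "?L < y"
  then obtain k where k: "k \<ge> 1" "a k / ereal (real k) < y" by (auto simp: INF_less_iff)
  obtain c where c: "a k / ereal (real k) < ereal c" "ereal c < y" using ereal_dense2[OF k(2)] by blast
  obtain d where d: "ereal c < ereal d" "ereal d < y" using ereal_dense2[OF c(2)] by blast
  obtain D where D: "\<forall>j\<in>{1..k}. a j \<le> ereal D" using finite_ereal_bound[of "{1..k}" a] fin by auto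
  \<comment> \<open>A numerical sequence is a subadditive sequence for the identity of the one-point
    space \<open>unit\<close>, so the orbit-cutting bound applies to it.\<close>
  have "\<exists>B. \<forall>M\<ge>1. \<forall>x::unit. a M \<le> ereal (real M * c + B)"
  proof (rule subadditive_linear_bound[of id "\<lambda>n _. a n" k D c])
    show "subadditive_sequence id (\<lambda>n _. a n)" using sub by (auto simp: subadditive_sequence_def)
    show "\<exists>j. 1 \<le> j \<and> j \<le> k \<and> a j \<le> ereal (real j * c)"
      using k c(1) by (intro exI[of _ k]) (auto simp flip: ereal_div_nat_le_iff)
  qed (use D in auto)
  then obtain B where B: "\<And>M. M \<ge> 1 \<Longrightarrow> a M \<le> ereal (real M * c + B)" by blast
  have "(\<lambda>n. c + B / real n) \<longlonglongrightarrow> c + 0" by (intro tendsto_intros lim_const_over_n)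
  then have "eventually (\<lambda>n. c + B / real n < d) sequentially" using d by (auto dest: order_tendstoD)
  then show "eventually (\<lambda>n. a n / ereal (real n) < y) sequentially"
    using eventually_ge_at_top[of 1]
  proof eventually_elim
    case (elim n)
    have "a n / ereal (real n) \<le> ereal (c + B / real n)"
      using B[of n] elim(2) by (subst ereal_div_nat_le_iff) (simp_all add: distrib_left)
    also have "\<dots> < ereal d" using elim by simp
    finally show ?case using d by simp
  qed
qed

section \<open>Upper semi-continuity and points of maximal growth\<close>

lemma usc_attains_max:
  fixes f :: "'a::topological_space \<Rightarrow> ereal"
  assumes c: "compact (UNIV :: 'a set)" and u: "upper_semicontinuous f"
  shows "\<exists>x. \<forall>y. f y \<le> f x"
proof (rule ccontr)
  assume "\<nexists>x. \<forall>y. f y \<le> f x"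
  \<comment> \<open>Without a maximum every point lies strictly below some value; a finite subcover
    fails to cover the point that gives its own largest value.\<close>
  then have cov: "UNIV \<subseteq> (\<Union>y\<in>UNIV. {x. f x < f y})" by (force simp: not_le)
  obtain Y where Y: "finite Y" "UNIV \<subseteq> (\<Union>y\<in>Y. {x. f x < f y})"
    using compactE_image[OF c _ cov] u by (auto simp: upper_semicontinuous_def)
  then have "Y \<noteq> {}" by auto
  then have "Max (f ` Y) \<in> f ` Y" using Y by (intro Max_in) auto
  then obtain z where z: "z \<in> Y" "f z = Max (f ` Y)" by force
  obtain y where "y \<in> Y" "f z < f y" using Y(2) by blast
  then show False using z Y(1) by (simp add: leD)
qed

lemma usc_bounded_above:
  fixes f :: "'a::topological_space \<Rightarrow> ereal"
  assumes "compact (UNIV :: 'a set)" "upper_semicontinuous f" "\<And>x. f x \<noteq> \<infinity>"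
  shows "\<exists>b\<ge>0. \<forall>x. f x \<le> ereal b"
proof -
  obtain x where x: "\<And>y. f y \<le> f x" using usc_attains_max[OF assms(1,2)] by blast
  obtain b where "f x \<le> ereal b" using assms(3)[of x] by (cases "f x") auto
  then have "f y \<le> ereal (max 0 b)" for y
    using x[of y] order_trans[of "f y" "ereal b" "ereal (max 0 b)"] by auto
  then show ?thesis by (intro exI[of _ "max 0 b"]) auto
qed

lemma exists_point_of_maximal_growth:
  fixes f :: "nat \<Rightarrow> 'a::t2_space \<Rightarrow> ereal"
  assumes c: "compact (UNIV :: 'a set)"
    and usc: "\<And>n. n \<ge> 1 \<Longrightarrow> upper_semicontinuous (f n)"
    and fin: "\<And>n x. n \<ge> 1 \<Longrightarrow> f n x \<noteq> \<infinity>"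
    and sub: "subadditive_sequence T f"
    and gr: "\<And>n. n \<ge> 1 \<Longrightarrow> ereal \<gamma> \<le> (SUP x. f n x / ereal (real n))"
  shows "\<exists>x. \<forall>n\<ge>1. ereal (real n * \<gamma>) \<le> f n x"
proof -
  \<comment> \<open>One index \<open>i\<close> governs both the time horizon \<open>Suc i\<close>
    and the tolerance \<open>1 / Suc i\<close>. The sets are thus nested, and a point in all of them
    satisfies every bound without loss.\<close>
  define K where "K i = {x. \<forall>k\<in>{1..Suc i}. ereal (real k * (\<gamma> - 1 / real (Suc i))) \<le> f k x}" for i
  have clK: "closed (K i)" for i
  proof -
    have "closed {x. ereal d \<le> f k x}" if "k \<ge> 1" for d k
    proof -
      have "{x. ereal d \<le> f k x} = - {x. f k x < ereal d}" by (auto simp: not_less)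
      then show ?thesis using usc[OF that] by (simp add: upper_semicontinuous_def closed_def)
    qed
    moreover have "K i = (\<Inter>k\<in>{1..Suc i}. {x. ereal (real k * (\<gamma> - 1 / real (Suc i))) \<le> f k x})"
      by (auto simp: K_def)
    ultimately show ?thesis by (auto intro!: closed_INT)
  qed
  have ne: "K i \<noteq> {}" for i
  proof
    assume e: "K i = {}"
    define d where "d = \<gamma> - 1 / real (Suc i)"
    have "\<forall>k. \<exists>b. k \<ge> 1 \<longrightarrow> (\<forall>x. f k x \<le> ereal b)" using usc_bounded_above[OF c usc fin] by metis
    then obtain b where b: "\<And>k x. k \<ge> 1 \<Longrightarrow> f k x \<le> ereal (b k)" by metis
    have "\<exists>B. \<forall>M\<ge>1. \<forall>x. f M x \<le> ereal (real M * d + B)"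
    proof (rule subadditive_linear_bound[OF sub, of "Suc i" "Max (b ` {1..Suc i})"])
      fix k x assume k: "1 \<le> k" "k \<le> Suc i"
      have "b k \<le> Max (b ` {1..Suc i})" using k by (intro Max_ge) auto
      then show "f k x \<le> ereal (Max (b ` {1..Suc i}))" using b[OF k(1), of x] order_trans by fastforce
    next
      fix x
      have "x \<notin> K i" using e by simp
      then show "\<exists>k. 1 \<le> k \<and> k \<le> Suc i \<and> f k x \<le> ereal (real k * d)"
        unfolding K_def d_def by (auto simp: not_le intro: less_imp_le)
    qed
    then obtain B where B: "\<And>M x. M \<ge> 1 \<Longrightarrow> f M x \<le> ereal (real M * d + B)" by blast
    have le: "\<gamma> \<le> d + B / real M" if M: "M \<ge> 1" for M
    proof -
      have "(SUP x. f M x / ereal (real M)) \<le> ereal (d + B / real M)"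
        using B[OF M] M by (intro SUP_least, subst ereal_div_nat_le_iff) (simp_all add: distrib_left)
      then show ?thesis using gr[OF M] by (metis ereal_less_eq(3) order_trans)
    qed
    have "(\<lambda>n. d + B / real n) \<longlonglongrightarrow> d + 0" by (intro tendsto_intros lim_const_over_n)
    then have "\<gamma> \<le> d + 0" by (rule tendsto_lowerbound) (use le in \<open>auto simp: eventually_sequentially\<close>)
    then show False unfolding d_def by (simp add: field_simps)
  qed
  have dec: "K j \<subseteq> K i" if "i \<le> j" for i j
  proof
    fix x assume x: "x \<in> K j"
    show "x \<in> K i" unfolding K_def
    proof (intro CollectI ballI)
      fix k assume k: "k \<in> {1..Suc i}"
      have "1 / real (Suc j) \<le> 1 / real (Suc i)" using that by (simp add: frac_le)
      then have "real k * (\<gamma> - 1 / real (Suc i)) \<le> real k * (\<gamma> - 1 / real (Suc j))"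
        by (intro mult_left_mono) auto
      moreover have "ereal (real k * (\<gamma> - 1 / real (Suc j))) \<le> f k x" using x k that by (auto simp: K_def)
      ultimately show "ereal (real k * (\<gamma> - 1 / real (Suc i))) \<le> f k x"
        using ereal_less_eq(3) order_trans by blast
    qed
  qed
  have "UNIV \<inter> \<Inter>(range K) \<noteq> {}"
  proof (rule compact_imp_fip_image[OF c clK])
    fix I :: "nat set" assume I: "finite I"
    have "K (Max I) \<subseteq> K i" if "i \<in> I" for i using that I by (intro dec Max_ge)
    then show "UNIV \<inter> \<Inter>(K ` I) \<noteq> {}" using ne[of "Max I"] by blast
  qed
  then obtain x where x: "\<And>i. x \<in> K i" by auto
  show ?thesis
  proof (intro exI allI impI)
    fix n :: nat assume n: "n \<ge> 1"
    have "(\<lambda>i. 1 / real (Suc i)) \<longlonglongrightarrow> 0" using LIMSEQ_inverse_real_of_nat by (simp add: inverse_eq_divide)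
    then have "(\<lambda>i. ereal (real n * (\<gamma> - 1 / real (Suc i)))) \<longlonglongrightarrow> ereal (real n * (\<gamma> - 0))"
      by (intro tendsto_intros)
    moreover have "eventually (\<lambda>i. ereal (real n * (\<gamma> - 1 / real (Suc i))) \<le> f n x) sequentially"
      using eventually_ge_at_top[of n]
      by eventually_elim (use x n in \<open>auto simp: K_def\<close>)
    ultimately have "ereal (real n * (\<gamma> - 0)) \<le> f n x" by (rule tendsto_upperbound) simp
    then show "ereal (real n * \<gamma>) \<le> f n x" by simp
  qed
qed

section \<open>The extended integral\<close>

lemma usc_borel_measurable:
  assumes "upper_semicontinuous f"
  shows "f \<in> borel_measurable borel"
  by (rule borel_measurableI_less) (use assms in \<open>simp add: upper_semicontinuous_def\<close>)

text \<open>Differences of two extended integrals do not calculate well. Here a single nonnegative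
  integral is subtracted from a real constant, so that additivity, conditioning and monotone limits
  can be taken from the nonnegative integral even when the value is -\<infinity>.\<close>

lemma ext_integral_upper_bound:
  assumes ps: "prob_space M" and f[measurable]: "f \<in> borel_measurable M"
    and b: "0 \<le> b" "\<And>x. f x \<le> ereal b"
  shows "ext_integral M f = ereal b - enn2ereal (\<integral>\<^sup>+x. e2ennreal (ereal b - f x) \<partial>M)"
proof -
  interpret prob_space M by fact
  let ?P = "\<integral>\<^sup>+x. e2ennreal (f x) \<partial>M" and ?N = "\<integral>\<^sup>+x. e2ennreal (- f x) \<partial>M"
  let ?J = "\<integral>\<^sup>+x. e2ennreal (ereal b - f x) \<partial>M"
  \<comment> \<open>The positive part plus \<open>b - f\<close> equals \<open>b\<close> plus the
    negative part: an identity without subtraction of parts, valid also where \<open>f x\<close> is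
    -\<infinity>.\<close>
  have pt: "e2ennreal (f x) + e2ennreal (ereal b - f x) = ennreal b + e2ennreal (- f x)" for x
  proof (cases "f x")
    case (real r)
    then show ?thesis using b(1) b(2)[of x]
      by (cases "r \<ge> 0") (auto simp: e2ennreal_ereal ennreal_neg simp flip: ennreal_plus)
  qed (use b(2)[of x] in \<open>auto simp: e2ennreal_neg\<close>)
  have "?P + ?J = (\<integral>\<^sup>+x. e2ennreal (f x) + e2ennreal (ereal b - f x) \<partial>M)"
    by (rule nn_integral_add[symmetric]) measurable
  also have "\<dots> = (\<integral>\<^sup>+x. ennreal b \<partial>M) + ?N" unfolding pt by (rule nn_integral_add) measurable
  also have "(\<integral>\<^sup>+x. ennreal b \<partial>M) = ennreal b" by (simp add: emeasure_space_1)
  finally have eq: "?P + ?J = ennreal b + ?N" .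
  have "?P \<le> (\<integral>\<^sup>+x. ennreal b \<partial>M)"
    by (intro nn_integral_mono) (metis b(2) e2ennreal_ereal e2ennreal_mono)
  also have "\<dots> < \<top>" by (simp add: emeasure_space_1)
  finally have "?P \<noteq> \<top>" by simp
  then obtain p where p: "?P = ennreal p" "p \<ge> 0" by (cases ?P) auto
  show ?thesis
  proof (cases ?J)
    case (real j)
    then have "?N \<noteq> \<top>" using eq p by (auto simp flip: ennreal_plus)
    then obtain n where n: "?N = ennreal n" "n \<ge> 0" by (cases ?N) auto
    have "p + j = b + n" using eq p n real b(1) by (simp flip: ennreal_plus)
    then show ?thesis unfolding ext_integral_def using p n real by simp
  next
    case top
    then have "ennreal b + ?N = \<top>" using eq by simp
    then have "?N = \<top>" by (simp add: ennreal_add_eq_top)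
    then show ?thesis unfolding ext_integral_def using p top by simp
  qed
qed

lemma ext_integral_mono:
  assumes "\<And>x. f x \<le> g x"
  shows "ext_integral M f \<le> ext_integral M g"
  unfolding ext_integral_def
  by (intro ereal_minus_mono less_eq_ennreal.rep_eq[THEN iffD1] nn_integral_mono e2ennreal_mono)
     (use assms in auto)

lemma ext_integral_add:
  assumes ps: "prob_space M" and [measurable]: "f \<in> borel_measurable M" "g \<in> borel_measurable M"
    and b: "0 \<le> b" "\<And>x. f x \<le> ereal b" and c: "0 \<le> c" "\<And>x. g x \<le> ereal c"
  shows "ext_integral M (\<lambda>x. f x + g x) = ext_integral M f + ext_integral M g"
proof -
  have s: "f x + g x \<le> ereal (b + c)" for x using add_mono[OF b(2)[of x] c(2)[of x]] by simp
  have pt: "e2ennreal (ereal (b + c) - (f x + g x)) = e2ennreal (ereal b - f x) + e2ennreal (ereal c - g x)" for x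
  proof -
    have "ereal (b + c) - (f x + g x) = (ereal b - f x) + (ereal c - g x)"
      using b(2)[of x] c(2)[of x] by (cases "f x"; cases "g x") auto
    moreover have "0 \<le> ereal b - f x" "0 \<le> ereal c - g x"
      using b(2)[of x] c(2)[of x] by (cases "f x"; cases "g x"; auto)+
    ultimately show ?thesis 
      by (simp add: enn2ereal_inject[symmetric] plus_ennreal.rep_eq enn2ereal_e2ennreal)
  qed
  have "(\<integral>\<^sup>+x. e2ennreal (ereal (b + c) - (f x + g x)) \<partial>M) =
    (\<integral>\<^sup>+x. e2ennreal (ereal b - f x) \<partial>M) + (\<integral>\<^sup>+x. e2ennreal (ereal c - g x) \<partial>M)"
    unfolding pt by (rule nn_integral_add) measurable
  moreover have "ext_integral M (\<lambda>x. f x + g x) =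
      ereal (b + c) - enn2ereal (\<integral>\<^sup>+x. e2ennreal (ereal (b + c) - (f x + g x)) \<partial>M)"
    using b c s by (intro ext_integral_upper_bound ps) auto
  moreover have "ext_integral M f = ereal b - enn2ereal (\<integral>\<^sup>+x. e2ennreal (ereal b - f x) \<partial>M)"
    using b by (intro ext_integral_upper_bound ps) auto
  moreover have "ext_integral M g = ereal c - enn2ereal (\<integral>\<^sup>+x. e2ennreal (ereal c - g x) \<partial>M)"
    using c by (intro ext_integral_upper_bound ps) auto
  ultimately show ?thesis
    by (cases "\<integral>\<^sup>+x. e2ennreal (ereal b - f x) \<partial>M"; cases "\<integral>\<^sup>+x. e2ennreal (ereal c - g x) \<partial>M")
       (auto simp flip: ennreal_plus)
qed

text \<open>Monotone convergence for the increasing nonnegative functions \<open>b - g k\<close>.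
  The limit \<open>f\<close> is bounded only from above, so the infimum of the integrals may be
  -\<infinity>.\<close>

lemma ext_integral_INF:
  fixes g :: "nat \<Rightarrow> 'a \<Rightarrow> real"
  assumes ps: "prob_space M" and int: "\<And>k. integrable M (g k)"
    and dec: "\<And>k x. g (Suc k) x \<le> g k x" and b: "0 \<le> b" "\<And>x. g 0 x \<le> b"
    and f: "\<And>x. f x = (INF k. ereal (g k x))"
  shows "ext_integral M f = (INF k. ereal (\<integral>x. g k x \<partial>M))"
proof -
  interpret prob_space M by fact
  have gb: "g k x \<le> b" for k x using lift_Suc_antimono_le[of "\<lambda>k. g k x" 0 k] dec b(2)[of x] by force
  have [measurable]: "g k \<in> borel_measurable M" for k using int by auto
  have fm: "f \<in> borel_measurable M" unfolding f[abs_def] by measurable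
  have fb: "f x \<le> ereal b" for x unfolding f using gb by (auto intro: INF_lower2)
  have e: "e2ennreal (ereal b - f x) = (SUP k. ennreal (b - g k x))" for x
  proof (rule LIMSEQ_unique)
    have "ereal b - f x = (SUP k. ereal b - ereal (g k x))"
      unfolding f by (rule SUP_ereal_minus_right[symmetric]) auto
    moreover have "incseq (\<lambda>k. ereal b - ereal (g k x))" using dec by (intro incseq_SucI) simp
    ultimately have "(\<lambda>k. ereal b - ereal (g k x)) \<longlonglongrightarrow> ereal b - f x" by (simp add: LIMSEQ_SUP)
    then have "(\<lambda>k. e2ennreal (ereal b - ereal (g k x))) \<longlonglongrightarrow> e2ennreal (ereal b - f x)"
      by (rule tendsto_e2ennrealI)
    then show "(\<lambda>k. ennreal (b - g k x)) \<longlonglongrightarrow> e2ennreal (ereal b - f x)" by simp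
    show "(\<lambda>k. ennreal (b - g k x)) \<longlonglongrightarrow> (SUP k. ennreal (b - g k x))"
      using dec by (intro LIMSEQ_SUP incseq_SucI ennreal_leI) (simp add: diff_left_mono)
  qed
  have J: "(\<integral>\<^sup>+x. e2ennreal (ereal b - f x) \<partial>M) = (SUP k. \<integral>\<^sup>+x. ennreal (b - g k x) \<partial>M)"
    unfolding e
  proof (rule nn_integral_monotone_convergence_SUP)
    show "incseq (\<lambda>k x. ennreal (b - g k x))"
      using dec by (intro incseq_SucI le_funI ennreal_leI) (simp add: diff_left_mono)
  qed measurable
  have Jk: "(\<integral>\<^sup>+x. ennreal (b - g k x) \<partial>M) = ennreal (b - (\<integral>x. g k x \<partial>M))" 
    and gi: "(\<integral>x. g k x \<partial>M) \<le> b" for k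
  proof -
    have "(\<integral>\<^sup>+x. ennreal (b - g k x) \<partial>M) = ennreal (\<integral>x. b - g k x \<partial>M)"
      using int gb by (intro nn_integral_eq_integral) auto
    then show "(\<integral>\<^sup>+x. ennreal (b - g k x) \<partial>M) = ennreal (b - (\<integral>x. g k x \<partial>M))"
      using int by (simp add: prob_space)
    show "(\<integral>x. g k x \<partial>M) \<le> b"
      using integral_mono[of M "g k" "\<lambda>_. b"] int gb by (simp add: prob_space)
  qed
  have "ext_integral M f = ereal b - enn2ereal (SUP k. ennreal (b - (\<integral>x. g k x \<partial>M)))"
    unfolding ext_integral_upper_bound[OF ps fm b(1) fb] J Jk ..
  also have "enn2ereal (SUP k. ennreal (b - (\<integral>x. g k x \<partial>M))) = (SUP k. ereal (b - (\<integral>x. g k x \<partial>M)))"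
  proof -
    have "0 \<le> (SUP k. ereal (b - (\<integral>x. g k x \<partial>M)))" using gi by (intro SUP_upper2[of 0]) auto
    then show ?thesis using gi by (simp add: Sup_ennreal.rep_eq image_image sup_absorb2)
  qed
  also have "ereal b - \<dots> = (INF k. ereal b - ereal (b - (\<integral>x. g k x \<partial>M)))"
    by (rule INF_ereal_minus_right[symmetric]) auto
  finally show ?thesis by simp
qed

section \<open>Integrals against invariant and conditional measures\<close>

lemma invariant_measures_distr:
  assumes "continuous_on UNIV T"
  shows "\<mu> \<in> invariant_measures T \<longleftrightarrow> \<mu> \<in> borel_probs \<and> distr \<mu> borel T = \<mu>"
proof -
  have T: "T \<in> borel_measurable \<mu>" if "sets \<mu> = sets borel"
    using borel_measurable_continuous_onI[OF assms] that measurable_cong_sets by blast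
  have "(\<forall>A\<in>sets borel. emeasure \<mu> (T -` A) = emeasure \<mu> A) \<longleftrightarrow> distr \<mu> borel T = \<mu>"
    if s: "sets \<mu> = sets borel"
  proof -
    have sp: "space \<mu> = UNIV" using s by (auto dest: sets_eq_imp_space_eq)
    have e: "emeasure (distr \<mu> borel T) A = emeasure \<mu> (T -` A)" if "A \<in> sets borel" for A
      using that T[OF s] sp by (simp add: emeasure_distr)
    show ?thesis
    proof
      assume "\<forall>A\<in>sets borel. emeasure \<mu> (T -` A) = emeasure \<mu> A"
      then show "distr \<mu> borel T = \<mu>" using e s by (intro measure_eqI) auto
    next
      assume "distr \<mu> borel T = \<mu>"
      then show "\<forall>A\<in>sets borel. emeasure \<mu> (T -` A) = emeasure \<mu> A" using e by simp
    qed
  qed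
  then show ?thesis by (auto simp: invariant_measures_def borel_probs_def)
qed

lemma ext_integral_invariant:
  assumes T: "continuous_on UNIV T" and m: "\<mu> \<in> invariant_measures T" and f: "f \<in> borel_measurable borel"
  shows "ext_integral \<mu> (\<lambda>x. f (T x)) = ext_integral \<mu> f"
proof -
  have s: "sets \<mu> = sets borel" and d: "distr \<mu> borel T = \<mu>"
    using m invariant_measures_distr[OF T] by (auto simp: borel_probs_def)
  have Tm: "T \<in> measurable \<mu> borel"
    using borel_measurable_continuous_onI[OF T] s measurable_cong_sets by blast
  have "(\<integral>\<^sup>+x. h x \<partial>\<mu>) = (\<integral>\<^sup>+x. h (T x) \<partial>\<mu>)" if "h \<in> borel_measurable borel" for h :: "'a \<Rightarrow> ennreal"
    using nn_integral_distr[OF Tm, of h] that by (simp add: d measurable_cong_sets[OF s refl])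
  from this[of "\<lambda>x. e2ennreal (f x)"] this[of "\<lambda>x. e2ennreal (- f x)"] f
  show ?thesis unfolding ext_integral_def by simp
qed

lemma nn_integral_uniform_measure_split:
  assumes ps: "prob_space M" and A: "A \<in> sets M" and t: "0 < measure M A" "measure M A < 1"
    and f[measurable]: "f \<in> borel_measurable M"
  shows "(\<integral>\<^sup>+x. f x \<partial>M) = ennreal (measure M A) * (\<integral>\<^sup>+x. f x \<partial>uniform_measure M A) +
      ennreal (1 - measure M A) * (\<integral>\<^sup>+x. f x \<partial>uniform_measure M (space M - A))"
proof -
  interpret prob_space M by fact
  have [measurable]: "A \<in> sets M" by fact
  have c: "measure M (space M - A) = 1 - measure M A" using A by (rule prob_compl)
  have *: "ennreal (measure M B) * (\<integral>\<^sup>+x. f x \<partial>uniform_measure M B) = (\<integral>\<^sup>+x. f x * indicator B x \<partial>M)"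
    if [measurable]: "B \<in> sets M" and "0 < measure M B" for B
    using that by (simp add: nn_integral_uniform_measure emeasure_eq_measure ennreal_times_divide
        mult.commute[of "ennreal _"] mult_divide_eq_ennreal)
  have "(\<integral>\<^sup>+x. f x \<partial>M) = (\<integral>\<^sup>+x. f x * indicator A x + f x * indicator (space M - A) x \<partial>M)"
    by (intro nn_integral_cong) (auto simp: indicator_def)
  also have "\<dots> = (\<integral>\<^sup>+x. f x * indicator A x \<partial>M) + (\<integral>\<^sup>+x. f x * indicator (space M - A) x \<partial>M)"
    by (rule nn_integral_add) measurable
  finally show ?thesis using *[of A] *[of "space M - A"] A t c by simp
qed

lemma ext_integral_uniform_measure_split:
  assumes ps: "prob_space M" and A: "A \<in> sets M" and t: "0 < measure M A" "measure M A < 1"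
    and f: "f \<in> borel_measurable M" and b: "0 \<le> b" "\<And>x. f x \<le> ereal b"
  shows "ext_integral M f = ereal (measure M A) * ext_integral (uniform_measure M A) f +
      ereal (1 - measure M A) * ext_integral (uniform_measure M (space M - A)) f"
proof -
  interpret prob_space M by fact
  have c: "measure M (space M - A) = 1 - measure M A" using A by (rule prob_compl)
  let ?J = "\<lambda>M. \<integral>\<^sup>+x. e2ennreal (ereal b - f x) \<partial>M"
  define t where "t = measure M A"
  have t01: "0 < t" "t < 1" using t by (auto simp: t_def)
  have "prob_space (uniform_measure M A)" "prob_space (uniform_measure M (space M - A))"
    using t c by (auto intro!: prob_space_uniform_measure simp: emeasure_eq_measure)
  then have e: "ext_integral (uniform_measure M A) f = ereal b - enn2ereal (?J (uniform_measure M A))"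
     "ext_integral (uniform_measure M (space M - A)) f = ereal b - enn2ereal (?J (uniform_measure M (space M - A)))"
     "ext_integral M f = ereal b - enn2ereal (?J M)"
    using f b ps by (auto intro!: ext_integral_upper_bound simp: uniform_measure_def)
  have "?J M = ennreal t * ?J (uniform_measure M A) + ennreal (1 - t) * ?J (uniform_measure M (space M - A))"
    unfolding t_def by (rule nn_integral_uniform_measure_split[OF ps A t]) (use f in measurable)
  \<comment> \<open>The weights add up to 1, which distributes the constant \<open>b\<close>. Both
    are strictly positive, so an infinite conditional integral stays infinite after weighting and
    the two sides are -\<infinity> together.\<close>
  moreover have "ereal b - enn2ereal (ennreal t * i + ennreal (1 - t) * j) =
      ereal t * (ereal b - enn2ereal i) + ereal (1 - t) * (ereal b - enn2ereal j)" for i j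
  proof (cases i; cases j)
    fix r s assume "i = ennreal r" "0 \<le> r" "j = ennreal s" "0 \<le> s"
    moreover from this have "ennreal t * i + ennreal (1 - t) * j = ennreal (t * r + (1 - t) * s)"
      using t01 by (simp add: ennreal_mult' ennreal_plus)
    moreover have "0 \<le> t * r + (1 - t) * s" using t01 calculation by simp
    ultimately show ?thesis by (simp add: algebra_simps)
  qed (use t01 in \<open>auto simp: ennreal_mult_top ennreal_top_mult simp flip: ennreal_mult'\<close>)
  ultimately show ?thesis unfolding e t_def[symmetric] by simp
qed

text \<open>Lipschitz regularisation from above: a value of \<open>f\<close> at \<open>y\<close>
  counts at \<open>x\<close> with the penalty \<open>k * dist x y\<close>, which makes the supremum
  \<open>k\<close>-Lipschitz. Truncating \<open>f\<close> at \<open>-k\<close> keeps it real where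
  \<open>f\<close> is -\<infinity>, and the truncation vanishes in the limit.\<close>

lemma usc_decreasing_continuous_approx:
  fixes f :: "'a::metric_space \<Rightarrow> ereal"
  assumes u: "upper_semicontinuous f" and b: "0 \<le> b" "\<And>x. f x \<le> ereal b"
  shows "\<exists>g :: nat \<Rightarrow> 'a \<Rightarrow> real. (\<forall>k. continuous_on UNIV (g k)) \<and> (\<forall>k x. g (Suc k) x \<le> g k x) \<and>
     (\<forall>x. g 0 x \<le> b) \<and> (\<forall>x. f x = (INF k. ereal (g k x)))"
proof -
  define h where "h k y = real_of_ereal (max (f y) (- ereal (real k)))" for k y
  have h: "ereal (h k y) = max (f y) (- ereal (real k))" for k y
    using b(2)[of y] unfolding h_def by (cases "f y") (auto simp: max_def)
  have hb: "h k y \<le> b" for k y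
  proof -
    have "ereal (h k y) \<le> ereal b" unfolding h using b by (simp add: order_trans[of _ 0])
    then show ?thesis by simp
  qed
  have hdec: "h (Suc k) y \<le> h k y" for k y
  proof -
    have "ereal (h (Suc k) y) \<le> ereal (h k y)" unfolding h by (intro max.mono) auto
    then show ?thesis by simp
  qed
  define g where "g k x = (SUP y. h k y - real k * dist x y)" for k x
  have hd: "h k y - real k * dist x y \<le> b" for k x y
  proof -
    have "0 \<le> real k * dist x y" by simp
    then show ?thesis using hb[of k y] by linarith
  qed
  have bdd: "bdd_above (range (\<lambda>y. h k y - real k * dist x y))" for k x
    using hd by (intro bdd_aboveI[of _ b]) auto
  have lip: "g k x \<le> g k x' + real k * dist x x'" for k x x'
    unfolding g_def[of k x]
  proof (rule cSUP_least)
    fix y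
    have "real k * dist x' y \<le> real k * (dist x y + dist x x')"
      using dist_triangle3[of x' y x] by (intro mult_left_mono) (auto simp: dist_commute)
    moreover have "h k y - real k * dist x' y \<le> g k x'" unfolding g_def by (rule cSUP_upper[OF _ bdd]) simp
    ultimately show "h k y - real k * dist x y \<le> g k x' + real k * dist x x'" by (simp add: algebra_simps)
  qed simp
  have "continuous_on UNIV (g k)" for k
  proof (rule lipschitz_on_continuous_on[of "real k"], rule lipschitz_onI)
    fix x y show "dist (g k x) (g k y) \<le> real k * dist x y"
      using lip[of k x y] lip[of k y x] by (auto simp: dist_real_def dist_commute abs_le_iff)
  qed simp
  moreover have "g (Suc k) x \<le> g k x" for k x
    unfolding g_def
  proof (rule cSUP_mono[OF _ bdd])
    fix y
    have "real k * dist x y \<le> real (Suc k) * dist x y" by (intro mult_right_mono) auto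
    then show "\<exists>y'\<in>UNIV. h (Suc k) y - real (Suc k) * dist x y \<le> h k y' - real k * dist x y'"
      using hdec[of k y] by (intro bexI[of _ y]) auto
  qed simp
  moreover have "g 0 x \<le> b" for x unfolding g_def by (rule cSUP_least) (use hd[of 0] in auto)
  moreover have "f x = (INF k. ereal (g k x))" for x
  proof (rule antisym)
    have "h k x \<le> g k x" for k unfolding g_def using cSUP_upper[OF UNIV_I bdd, of k x x] by simp
    moreover have "f x \<le> ereal (h k x)" for k unfolding h by simp
    ultimately show "f x \<le> (INF k. ereal (g k x))"
      by (meson INF_greatest ereal_less_eq(3) order_trans)
    show "(INF k. ereal (g k x)) \<le> f x"
    proof (rule ccontr)
      assume "\<not> ?thesis"
      then have "f x < (INF k. ereal (g k x))" by (simp add: not_le)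
      then obtain c where c: "f x < ereal c" "ereal c < (INF k. ereal (g k x))" using ereal_dense2 by blast
      have "open {y. f y < ereal c}" using u by (simp add: upper_semicontinuous_def)
      then obtain d where d: "d > 0" "ball x d \<subseteq> {y. f y < ereal c}" using c(1) open_contains_ball by blast
      \<comment> \<open>The first condition puts the truncation level \<open>-k\<close> below
        \<open>c\<close>, which settles the points near \<open>x\<close>. The second makes the
        penalty at distance \<open>d\<close> exceed \<open>b - c\<close>, which settles the
        others.\<close>
      obtain k :: nat where k: "real k > max (- c) ((b - c) / d)" using reals_Archimedean2 by blast
      have "g k x \<le> c" unfolding g_def
      proof (rule cSUP_least)
        fix y
        show "h k y - real k * dist x y \<le> c"
        proof (cases "dist x y < d")
          case True
          then have "f y < ereal c" using d(2) by auto
          then have "ereal (h k y) \<le> ereal c" unfolding h using k by auto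
          moreover have "0 \<le> real k * dist x y" by simp
          ultimately show ?thesis by (simp only: ereal_less_eq)
        next
          case False
          have "b - c < real k * d" using k d(1) by (simp add: divide_less_eq)
          also have "\<dots> \<le> real k * dist x y" using False by (intro mult_left_mono) auto
          finally show ?thesis using hb[of k y] by simp
        qed
      qed simp
      moreover have "(INF k. ereal (g k x)) \<le> ereal (g k x)" by (rule INF_lower) simp
      ultimately show False using c(2) by (metis ereal_less_eq(3) leD order_trans)
    qed
  qed
  ultimately show ?thesis by blast
qed

section \<open>Empirical measures\<close>

text \<open>As an infimum of weakly continuous functionals, the integral of \<open>f\<close> is
  weakly upper semi-continuous. The auxiliary sequence \<open>h\<close> serves two uses: a constant
  \<open>h\<close> shows that lower bounds survive weak limits, and a maximising \<open>h\<close>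
  yields attained suprema.\<close>

lemma weakly_converges_ext_integral_ge:
  fixes f :: "'a::metric_space \<Rightarrow> ereal"
  assumes c: "compact (UNIV :: 'a set)" and u: "upper_semicontinuous f" and fin: "\<And>x. f x \<noteq> \<infinity>"
    and m: "\<And>n. \<mu>s n \<in> borel_probs" "\<mu> \<in> borel_probs" and w: "weakly_converges \<mu>s \<mu>"
    and l: "h \<longlonglongrightarrow> l" and le: "\<And>n. h n \<le> ext_integral (\<mu>s n) f"
  shows "l \<le> ext_integral \<mu> f"
proof -
  obtain b where b: "b \<ge> 0" "\<And>x. f x \<le> ereal b" using usc_bounded_above[OF c u fin] by blast
  obtain g :: "nat \<Rightarrow> 'a \<Rightarrow> real" where g: "\<And>k. continuous_on UNIV (g k)" "\<And>k x. g (Suc k) x \<le> g k x"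
    "\<And>x. g 0 x \<le> b" "\<And>x. f x = (INF k. ereal (g k x))"
    using usc_decreasing_continuous_approx[OF u b] by blast
  have e: "ext_integral \<nu> f = (INF k. ereal (\<integral>x. g k x \<partial>\<nu>))" if "\<nu> \<in> borel_probs" for \<nu>
  proof (rule ext_integral_INF)
    show "integrable \<nu> (g k)" for k
      using that by (intro integrable_continuous_compact c g) (auto simp: borel_probs_def prob_space.finite_measure)
  qed (use that g b in \<open>auto simp: borel_probs_def\<close>)
  show ?thesis unfolding e[OF m(2)]
  proof (rule INF_greatest)
    fix k
    have lim: "(\<lambda>n. ereal (\<integral>x. g k x \<partial>\<mu>s n)) \<longlonglongrightarrow> ereal (\<integral>x. g k x \<partial>\<mu>)"
      using w g(1) by (auto simp: weakly_converges_def)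
    have "h n \<le> ereal (\<integral>x. g k x \<partial>\<mu>s n)" for n
      using le[of n] unfolding e[OF m(1)] by (rule order_trans) (rule INF_lower, simp)
    then show "l \<le> ereal (\<integral>x. g k x \<partial>\<mu>)" using LIMSEQ_le[OF l lim] by blast
  qed
qed

text \<open>The direct method: a maximising sequence has a weakly convergent subsequence,
  \<open>cl\<close> keeps its limit in \<open>S\<close>, and the hypothesis on \<open>F\<close> is
  sequential upper semi-continuity along it.\<close>

lemma weakly_closed_attains_max:
  fixes S :: "'a::metric_space measure set" and F :: "'a measure \<Rightarrow> ereal"
  assumes c: "compact (UNIV :: 'a set)" and S: "S \<subseteq> borel_probs" "S \<noteq> {}"
    and cl: "\<And>\<mu>s \<mu>. (\<And>n. \<mu>s n \<in> S) \<Longrightarrow> \<mu> \<in> borel_probs \<Longrightarrow> weakly_converges \<mu>s \<mu> \<Longrightarrow> \<mu> \<in> S"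
    and F: "\<And>\<mu>s \<mu> h l. (\<And>n. \<mu>s n \<in> S) \<Longrightarrow> \<mu> \<in> S \<Longrightarrow> weakly_converges \<mu>s \<mu> \<Longrightarrow>
      h \<longlonglongrightarrow> l \<Longrightarrow> (\<And>n. h n \<le> F (\<mu>s n)) \<Longrightarrow> l \<le> F \<mu>"
  shows "\<exists>\<mu>\<in>S. \<forall>\<nu>\<in>S. F \<nu> \<le> F \<mu>"
proof -
  have "F ` S \<noteq> {}" using S by simp
  then obtain h :: "nat \<Rightarrow> ereal" where h: "incseq h" "range h \<subseteq> F ` S" "Sup (F ` S) = (SUP i. h i)"
    using Sup_countable_SUP by meson
  have "\<forall>n. \<exists>\<mu>\<in>S. F \<mu> = h n"
  proof
    fix n
    have "h n \<in> F ` S" by (rule subsetD[OF h(2) rangeI])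
    then show "\<exists>\<mu>\<in>S. F \<mu> = h n" by force
  qed
  then obtain \<mu>s where \<mu>s: "\<And>n. \<mu>s n \<in> S" "\<And>n. F (\<mu>s n) = h n" by metis
  have bp: "\<mu>s n \<in> borel_probs" for n using \<mu>s(1) S(1) by blast
  obtain r \<mu> where r: "strict_mono r" "\<mu> \<in> borel_probs" "weakly_converges (\<mu>s \<circ> r) \<mu>"
    using borel_probs_seq_compact[OF c, of \<mu>s] bp by blast
  have \<mu>: "\<mu> \<in> S" by (rule cl[OF _ r(2,3)]) (simp add: \<mu>s)
  have L: "(h \<circ> r) \<longlonglongrightarrow> Sup (F ` S)" unfolding h(3) by (intro LIMSEQ_subseq_LIMSEQ LIMSEQ_SUP h r)
  have "Sup (F ` S) \<le> F \<mu>" by (rule F[OF _ \<mu> r(3) L]) (simp_all add: \<mu>s)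
  then show ?thesis using \<mu> SUP_le_iff by (metis order_refl)
qed

text \<open>Both \<mu> and its image under \<open>T\<close> are Borel probability measures, and
  agreement on the bumps already identifies them.\<close>

lemma invariant_measuresI:
  fixes T :: "'a::metric_space \<Rightarrow> 'a"
  assumes c: "compact (UNIV :: 'a set)" and T: "continuous_on UNIV T" and m: "\<mu> \<in> borel_probs"
    and eq: "\<And>g::'a \<Rightarrow> real. continuous_on UNIV g \<Longrightarrow> (\<integral>x. g (T x) \<partial>\<mu>) = (\<integral>x. g x \<partial>\<mu>)"
  shows "\<mu> \<in> invariant_measures T"
proof -
  have ps: "prob_space \<mu>" and s: "sets \<mu> = sets borel" using m by (auto simp: borel_probs_def)
  have Tm: "T \<in> measurable \<mu> borel"
    using borel_measurable_continuous_onI[OF T] by (simp add: measurable_cong_sets[OF s refl])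
  obtain B :: "nat \<Rightarrow> 'a set" where B: "topological_basis (range B)" "\<And>i j. \<exists>k. B i \<inter> B j = B k"
    using compact_metric_countable_basis[OF c] by blast
  have "distr \<mu> borel T = \<mu>"
  proof (rule borel_probs_eqI[OF c _ m B])
    show "distr \<mu> borel T \<in> borel_probs"
      using prob_space.prob_space_distr[OF ps Tm] by (simp add: borel_probs_def)
    fix i j
    show "(\<integral>x. bump (B i) j x \<partial>distr \<mu> borel T) = (\<integral>x. bump (B i) j x \<partial>\<mu>)"
      using integral_distr[OF Tm borel_measurable_continuous_onI[OF continuous_bump]]
        eq[OF continuous_bump] by simp
  qed
  then show ?thesis using invariant_measures_distr[OF T] m by blast
qed

lemma invariant_integral:
  assumes T: "continuous_on UNIV T" and m: "\<mu> \<in> invariant_measures T"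
    and g: "continuous_on UNIV (g :: _ \<Rightarrow> real)"
  shows "(\<integral>x. g (T x) \<partial>\<mu>) = (\<integral>x. g x \<partial>\<mu>)"
proof -
  have s: "sets \<mu> = sets borel" and d: "distr \<mu> borel T = \<mu>"
    using m invariant_measures_distr[OF T] by (auto simp: borel_probs_def)
  have Tm: "T \<in> measurable \<mu> borel"
    using borel_measurable_continuous_onI[OF T] by (simp add: measurable_cong_sets[OF s refl])
  show ?thesis using integral_distr[OF Tm borel_measurable_continuous_onI[OF g]] by (simp add: d)
qed

text \<open>Continuity of \<open>T\<close> makes \<open>g\<close> composed with \<open>T\<close>
  another admissible test function, so the two integrals have a common limit.\<close>

lemma invariant_measures_weakly_closed:
  fixes T :: "'a::metric_space \<Rightarrow> 'a"
  assumes c: "compact (UNIV :: 'a set)" and T: "continuous_on UNIV T"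
    and \<mu>s: "\<And>n. \<mu>s n \<in> invariant_measures T" and m: "\<mu> \<in> borel_probs" and w: "weakly_converges \<mu>s \<mu>"
  shows "\<mu> \<in> invariant_measures T"
proof (rule invariant_measuresI[OF c T m])
  fix g :: "'a \<Rightarrow> real" assume g: "continuous_on UNIV g"
  have gT: "continuous_on UNIV (\<lambda>x. g (T x))" using continuous_on_compose2[OF g T] by simp
  have "(\<lambda>n. \<integral>x. g (T x) \<partial>\<mu>s n) \<longlonglongrightarrow> (\<integral>x. g (T x) \<partial>\<mu>)" using w gT by (simp add: weakly_converges_def)
  moreover have "(\<lambda>n. \<integral>x. g (T x) \<partial>\<mu>s n) \<longlonglongrightarrow> (\<integral>x. g x \<partial>\<mu>)"
    using w g by (simp add: weakly_converges_def invariant_integral[OF T \<mu>s g])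
  ultimately show "(\<integral>x. g (T x) \<partial>\<mu>) = (\<integral>x. g x \<partial>\<mu>)" by (rule LIMSEQ_unique)
qed

text \<open>The uniform distribution on the times 0 to \<open>N\<close> is pushed along the orbit;
  starting at time 0 keeps the number of times, \<open>Suc N\<close>, positive for every
  \<open>N\<close>.\<close>

definition empirical_measure :: "('a::topological_space \<Rightarrow> 'a) \<Rightarrow> 'a \<Rightarrow> nat \<Rightarrow> 'a measure" where
  "empirical_measure T x N = distr (measure_pmf (pmf_of_set {..N})) borel (\<lambda>k. (T ^^ k) x)"

lemma empirical_measure_borel_probs: "empirical_measure T x N \<in> borel_probs"
  unfolding borel_probs_def empirical_measure_def
  by (auto intro!: prob_space.prob_space_distr measure_pmf.prob_space_axioms)

lemma integral_empirical_measure: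
  assumes "g \<in> borel_measurable borel"
  shows "(\<integral>y. g y \<partial>empirical_measure T x N) = (\<Sum>k\<le>N. g ((T ^^ k) x)) / real (Suc N)"
  unfolding empirical_measure_def
  by (subst integral_distr) (use assms in \<open>auto simp: integral_pmf_of_set\<close>)

text \<open>The Krylov-Bogolyubov argument: against an empirical measure, the integrals of
  \<open>g\<close> and of \<open>g\<close> composed with \<open>T\<close> telescope to a difference
  of two boundary values divided by \<open>Suc N\<close>, which tends to 0 because \<open>g\<close>
  is bounded.\<close>

lemma empirical_measure_subsequence:
  fixes T :: "'a::metric_space \<Rightarrow> 'a"
  assumes c: "compact (UNIV :: 'a set)" and T: "continuous_on UNIV T"
  shows "\<exists>r \<mu>. strict_mono r \<and> \<mu> \<in> invariant_measures T \<and> weakly_converges (empirical_measure T x \<circ> r) \<mu>"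
proof -
  obtain r \<mu> where r: "strict_mono r" "\<mu> \<in> borel_probs" and w: "weakly_converges (empirical_measure T x \<circ> r) \<mu>"
    using borel_probs_seq_compact[OF c, of "empirical_measure T x"] empirical_measure_borel_probs by blast
  have "\<mu> \<in> invariant_measures T"
  proof (rule invariant_measuresI[OF c T r(2)])
    fix g :: "'a \<Rightarrow> real" assume g: "continuous_on UNIV g"
    have gT: "continuous_on UNIV (\<lambda>x. g (T x))" using continuous_on_compose2[OF g T] by simp
    have "bounded (range g)" using c g by (intro compact_imp_bounded compact_continuous_image)
    then obtain b where b: "\<And>x. norm (g x) \<le> b" by (auto simp: bounded_iff)
    let ?I = "\<lambda>N g. \<integral>y. g y \<partial>empirical_measure T x N"
    have diff: "?I N (\<lambda>y. g (T y)) - ?I N g = (g ((T ^^ Suc N) x) - g x) / real (Suc N)" for N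
    proof -
      have "(\<Sum>k\<le>N. g (T ((T ^^ k) x))) - (\<Sum>k\<le>N. g ((T ^^ k) x)) = g ((T ^^ Suc N) x) - g x"
        by (induction N) auto
      then show ?thesis
        using borel_measurable_continuous_onI[OF g] borel_measurable_continuous_onI[OF gT]
        by (simp add: integral_empirical_measure diff_divide_distrib[symmetric] del: funpow.simps)
    qed
    have "(\<lambda>N. ?I N (\<lambda>y. g (T y)) - ?I N g) \<longlonglongrightarrow> 0"
    proof (rule Lim_null_comparison)
      show "eventually (\<lambda>N. norm (?I N (\<lambda>y. g (T y)) - ?I N g) \<le> 2 * b * inverse (real (Suc N))) sequentially"
      proof (intro always_eventually allI)
        fix N
        have "\<bar>g ((T ^^ Suc N) x) - g x\<bar> \<le> 2 * b" using b[of "(T ^^ Suc N) x"] b[of x] by simp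
        then show "norm (?I N (\<lambda>y. g (T y)) - ?I N g) \<le> 2 * b * inverse (real (Suc N))"
          unfolding diff by (simp add: divide_inverse abs_mult mult_right_mono del: funpow.simps of_nat_Suc)
      qed
      show "(\<lambda>N. 2 * b * inverse (real (Suc N))) \<longlonglongrightarrow> 0"
        using tendsto_mult[OF tendsto_const LIMSEQ_inverse_real_of_nat] by simp
    qed
    from LIMSEQ_subseq_LIMSEQ[OF this r(1)]
    have "(\<lambda>n. ?I (r n) (\<lambda>y. g (T y)) - ?I (r n) g) \<longlonglongrightarrow> 0" by (simp add: comp_def)
    moreover have "(\<lambda>n. ?I (r n) (\<lambda>y. g (T y)) - ?I (r n) g) \<longlonglongrightarrow> (\<integral>y. g (T y) \<partial>\<mu>) - (\<integral>y. g y \<partial>\<mu>)"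
      using w g gT by (intro tendsto_diff) (simp_all add: weakly_converges_def)
    ultimately show "(\<integral>y. g (T y) \<partial>\<mu>) = (\<integral>y. g y \<partial>\<mu>)" using LIMSEQ_unique by fastforce
  qed
  then show ?thesis using r w by blast
qed

text \<open>With \<open>F\<^sub>N = \<Sum>r<n. f\<^sub>N\<^sub>+\<^sub>r\<close>, subadditivity gives \<open>F\<^sub>N\<^sub>+\<^sub>1 x \<le> F\<^sub>N x + f\<^sub>n (T\<^sup>N x)\<close>.\<close>

lemma subadditive_orbit_sum:
  assumes sub: "subadditive_sequence T f" and n: "n \<ge> 1"
  shows "(\<Sum>r<n. f (Suc N + r) x) \<le> (\<Sum>r<n. f (Suc r) x) + (\<Sum>k=1..N. f n ((T ^^ k) x))"
proof (induction N)
  case (Suc N)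
  obtain n' where n': "n = Suc n'" using n by (cases n) auto
  have "(\<Sum>r<n. f (Suc (Suc N) + r) x) = (\<Sum>r<n'. f (Suc N + Suc r) x) + f (n + Suc N) x"
    by (simp add: n' add.commute)
  also have "\<dots> \<le> (\<Sum>r<n'. f (Suc N + Suc r) x) + (f n ((T ^^ Suc N) x) + f (Suc N) x)"
    using sub[unfolded subadditive_sequence_def, rule_format, of n "Suc N" x] n
    by (intro add_left_mono) simp
  also have "\<dots> = (\<Sum>r<n. f (Suc N + r) x) + f n ((T ^^ Suc N) x)"
    unfolding n' by (subst sum.lessThan_Suc_shift) (simp add: ac_simps del: funpow.simps)
  also have "\<dots> \<le> (\<Sum>r<n. f (Suc r) x) + (\<Sum>k=1..N. f n ((T ^^ k) x)) + f n ((T ^^ Suc N) x)"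
    using Suc.IH by (rule add_right_mono)
  finally show ?case by (simp add: add.assoc del: funpow.simps)
qed simp

text \<open>Splitting one long time into blocks of length \<open>n\<close> samples the orbit only
  along multiples of \<open>n\<close>, whereas the empirical measures weigh all times. Summing
  \<open>n\<close> consecutive offsets uses each time from 1 to \<open>N\<close> once, while the
  lower bounds add up to \<open>n * Suc N * \<gamma>\<close> up to a constant. This is averaged for
  each continuous majorant \<open>g j\<close> of \<open>f n\<close>, passed to the weak limit, and
  only then is the infimum over \<open>j\<close> taken.\<close>

lemma orbit_measure_of_maximal_growth:
  fixes T :: "'a::metric_space \<Rightarrow> 'a"
  assumes c: "compact (UNIV :: 'a set)" and T: "continuous_on UNIV T"
    and usc: "\<And>n. n \<ge> 1 \<Longrightarrow> upper_semicontinuous (f n)"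
    and fin: "\<And>n x. n \<ge> 1 \<Longrightarrow> f n x \<noteq> \<infinity>"
    and sub: "subadditive_sequence T f"
    and x: "\<And>n. n \<ge> 1 \<Longrightarrow> ereal (real n * \<gamma>) \<le> f n x"
  shows "\<exists>\<mu>\<in>invariant_measures T. \<forall>n\<ge>1. ereal (real n * \<gamma>) \<le> ext_integral \<mu> (f n)"
proof -
  obtain r \<mu> where r: "strict_mono r" and \<mu>: "\<mu> \<in> invariant_measures T"
    and w: "weakly_converges (empirical_measure T x \<circ> r) \<mu>"
    using empirical_measure_subsequence[OF c T] by blast
  have \<mu>b: "\<mu> \<in> borel_probs" using \<mu> invariant_measures_distr[OF T] by blast
  show ?thesis
  proof (intro bexI[OF _ \<mu>] allI impI)
    fix n :: nat assume n: "n \<ge> 1"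
    obtain b where b: "b \<ge> 0" "\<And>x. f n x \<le> ereal b" using usc_bounded_above[OF c usc[OF n] fin[OF n]] by blast
    obtain g :: "nat \<Rightarrow> 'a \<Rightarrow> real" where g: "\<And>k. continuous_on UNIV (g k)" "\<And>k x. g (Suc k) x \<le> g k x"
      "\<And>x. g 0 x \<le> b" "\<And>x. f n x = (INF k. ereal (g k x))"
      using usc_decreasing_continuous_approx[OF usc[OF n] b] by blast
    have e: "ext_integral \<mu> (f n) = (INF k. ereal (\<integral>x. g k x \<partial>\<mu>))"
    proof (rule ext_integral_INF)
      show "integrable \<mu> (g k)" for k
        using \<mu>b by (intro integrable_continuous_compact c g) (auto simp: borel_probs_def prob_space.finite_measure)
    qed (use \<mu>b g b in \<open>auto simp: borel_probs_def\<close>)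
    have "real n * \<gamma> \<le> (\<integral>x. g j x \<partial>\<mu>)" for j
    proof -
      have fg: "f n y \<le> ereal (g j y)" for y unfolding g(4) by (rule INF_lower) simp
      obtain D where D: "(\<Sum>r<n. f (Suc r) x) \<le> ereal D"
      proof -
        have "(\<Sum>r<n. f (Suc r) x) \<noteq> \<infinity>" using fin by (simp add: sum_Pinfty)
        then show thesis using that by (cases "\<Sum>r<n. f (Suc r) x") auto
      qed
      \<comment> \<open>\<open>D\<close> comes from the initial window,
        \<open>real n * real n * \<bar>\<gamma>\<bar>\<close> from the offsets below
        \<open>n\<close>, and \<open>g j x\<close> is the time-0 term, which the empirical measure
        counts but the orbit estimate does not.\<close>
      define C where "C = real n * real n * \<bar>\<gamma>\<bar> + D - g j x"
      have bd: "real n * \<gamma> - C * inverse (real (Suc N)) \<le> (\<integral>y. g j y \<partial>empirical_measure T x N)" for N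
      proof -
        have "ereal (\<Sum>r<n. real (Suc N + r) * \<gamma>) \<le> (\<Sum>r<n. f (Suc N + r) x)"
          unfolding sum_ereal[symmetric] by (intro sum_mono x) simp
        also have "\<dots> \<le> (\<Sum>r<n. f (Suc r) x) + (\<Sum>k=1..N. f n ((T ^^ k) x))"
          by (rule subadditive_orbit_sum[OF sub n])
        also have "\<dots> \<le> ereal D + (\<Sum>k=1..N. ereal (g j ((T ^^ k) x)))"
          by (intro add_mono D sum_mono fg)
        finally have 1: "(\<Sum>r<n. real (Suc N + r) * \<gamma>) \<le> D + (\<Sum>k=1..N. g j ((T ^^ k) x))" by simp
        have "\<bar>\<Sum>r<n. real r * \<gamma>\<bar> \<le> (\<Sum>r<n. real n * \<bar>\<gamma>\<bar>)"
        proof (rule order_trans[OF sum_abs], rule sum_mono)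
          fix r assume "r \<in> {..<n}"
          then show "\<bar>real r * \<gamma>\<bar> \<le> real n * \<bar>\<gamma>\<bar>" by (simp add: abs_mult mult_right_mono)
        qed
        then have "- (real n * real n * \<bar>\<gamma>\<bar>) \<le> (\<Sum>r<n. real r * \<gamma>)" by simp
        moreover have "(\<Sum>r<n. real (Suc N + r) * \<gamma>) = real n * real (Suc N) * \<gamma> + (\<Sum>r<n. real r * \<gamma>)"
        proof -
          have "real (Suc N + r) * \<gamma> = real (Suc N) * \<gamma> + real r * \<gamma>" for r
            unfolding of_nat_add by (rule distrib_right)
          then show ?thesis by (simp only: sum.distrib) simp
        qed
        moreover have "(\<Sum>k\<le>N. g j ((T ^^ k) x)) = g j x + (\<Sum>k=1..N. g j ((T ^^ k) x))"
          by (simp add: sum.atMost_shift sum.atLeast1_atMost_eq)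
        ultimately have "real n * real (Suc N) * \<gamma> - C \<le> (\<Sum>k\<le>N. g j ((T ^^ k) x))"
          using 1 unfolding C_def by linarith
        then have "(real n * real (Suc N) * \<gamma> - C) / real (Suc N) \<le> (\<Sum>k\<le>N. g j ((T ^^ k) x)) / real (Suc N)"
          by (intro divide_right_mono) auto
        then show ?thesis
          using borel_measurable_continuous_onI[OF g(1)]
          by (simp add: integral_empirical_measure diff_divide_distrib divide_inverse[of C])
      qed
      have "(\<lambda>N. real n * \<gamma> - C * inverse (real (Suc N))) \<longlonglongrightarrow> real n * \<gamma> - C * 0"
        by (intro tendsto_intros LIMSEQ_inverse_real_of_nat)
      from LIMSEQ_subseq_LIMSEQ[OF this r]
      have "(\<lambda>i. real n * \<gamma> - C * inverse (real (Suc (r i)))) \<longlonglongrightarrow> real n * \<gamma>" by (simp add: comp_def)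
      moreover have "(\<lambda>i. \<integral>y. g j y \<partial>empirical_measure T x (r i)) \<longlonglongrightarrow> (\<integral>y. g j y \<partial>\<mu>)"
        using w g(1) by (simp add: weakly_converges_def)
      ultimately show ?thesis by (rule LIMSEQ_le) (use bd in auto)
    qed
    then show "ereal (real n * \<gamma>) \<le> ext_integral \<mu> (f n)" unfolding e by (auto intro: INF_greatest)
  qed
qed

section \<open>Ergodic measures\<close>

lemma invariant_measures_probs: "\<mu> \<in> invariant_measures T \<Longrightarrow> \<mu> \<in> borel_probs"
  by (auto simp: invariant_measures_def borel_probs_def)

text \<open>Since \<open>A\<close> is its own preimage, intersecting with \<open>A\<close> commutes
  with taking preimages under \<open>T\<close>.\<close>

lemma uniform_measure_invariant:
  assumes m: "\<mu> \<in> invariant_measures T" and A: "A \<in> sets borel" "T -` A = A" "0 < measure \<mu> A"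
    and T: "continuous_on UNIV T"
  shows "uniform_measure \<mu> A \<in> invariant_measures T"
proof -
  have s: "sets \<mu> = sets borel" and ps: "prob_space \<mu>"
    and inv: "\<And>B. B \<in> sets borel \<Longrightarrow> emeasure \<mu> (T -` B) = emeasure \<mu> B"
    using m by (auto simp: invariant_measures_def)
  interpret prob_space \<mu> by fact
  have vim: "T -` B \<in> sets borel" if "B \<in> sets borel" for B
    using measurable_sets[OF borel_measurable_continuous_onI[OF T] that] by simp
  have "emeasure (uniform_measure \<mu> A) (T -` B) = emeasure (uniform_measure \<mu> A) B" if B: "B \<in> sets borel" for B
  proof -
    have "emeasure \<mu> (A \<inter> T -` B) = emeasure \<mu> (T -` (A \<inter> B))" using A(2) by (metis vimage_Int)
    also have "\<dots> = emeasure \<mu> (A \<inter> B)" using inv[of "A \<inter> B"] A(1) B by simp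
    finally show ?thesis using A(1) B vim s by simp
  qed
  moreover have "prob_space (uniform_measure \<mu> A)"
    using A(3) by (intro prob_space_uniform_measure) (auto simp: emeasure_eq_measure)
  ultimately show ?thesis using s by (simp add: invariant_measures_def)
qed

lemma integral_uniform_measure_split:
  fixes g :: "'a::topological_space \<Rightarrow> real"
  assumes c: "compact (UNIV :: 'a set)" and m: "\<mu> \<in> borel_probs"
    and A: "A \<in> sets borel" and t: "0 < measure \<mu> A" "measure \<mu> A < 1"
    and g: "continuous_on UNIV g"
  shows "(\<integral>x. g x \<partial>\<mu>) = measure \<mu> A * (\<integral>x. g x \<partial>uniform_measure \<mu> A) +
     (1 - measure \<mu> A) * (\<integral>x. g x \<partial>uniform_measure \<mu> (- A))"
proof -
  have s: "sets \<mu> = sets borel" and ps: "prob_space \<mu>" using m by (auto simp: borel_probs_def)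
  interpret prob_space \<mu> by fact
  have sp: "space \<mu> = UNIV" using s by (auto dest: sets_eq_imp_space_eq)
  have "bounded (range g)" using c g by (intro compact_imp_bounded compact_continuous_image)
  then obtain b where b: "\<And>x. norm (g x) \<le> b" by (auto simp: bounded_iff)
  have b0: "0 \<le> b" using order_trans[OF norm_ge_zero b] .
  have "measure \<mu> (- A) = 1 - measure \<mu> A" using prob_compl[of A] A s sp by (simp add: Compl_eq_Diff_UNIV)
  then have pA: "prob_space (uniform_measure \<mu> A)" "prob_space (uniform_measure \<mu> (- A))"
    using t by (auto intro!: prob_space_uniform_measure simp: emeasure_eq_measure)
  have e: "ext_integral \<nu> (\<lambda>x. ereal (g x)) = ereal (\<integral>x. g x \<partial>\<nu>)"
    if "prob_space \<nu>" "sets \<nu> = sets borel" for \<nu>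
    using that by (intro ext_integral_eq_integral integrable_continuous_compact c g prob_space.finite_measure)
  have "ext_integral \<mu> (\<lambda>x. ereal (g x)) =
     ereal (measure \<mu> A) * ext_integral (uniform_measure \<mu> A) (\<lambda>x. ereal (g x)) +
     ereal (1 - measure \<mu> A) * ext_integral (uniform_measure \<mu> (space \<mu> - A)) (\<lambda>x. ereal (g x))"
  proof (rule ext_integral_uniform_measure_split[OF ps _ t _ b0])
    show "(\<lambda>x. ereal (g x)) \<in> borel_measurable \<mu>"
      using borel_measurable_continuous_onI[OF g] by (simp add: measurable_cong_sets[OF s refl])
    show "ereal (g x) \<le> ereal b" for x using b[of x] by simp
  qed (use A s in simp)
  moreover have "space \<mu> - A = - A" using sp by auto
  ultimately show ?thesis using pA by (simp add: e ps s)
qed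

text \<open>A maximiser over a weakly closed face of a strictly convex continuous functional is an
  extreme point; this replaces the Krein--Milman theorem and the ergodic decomposition.\<close>

lemma exists_ergodic_in_face:
  fixes T :: "'a::metric_space \<Rightarrow> 'a"
  assumes c: "compact (UNIV :: 'a set)" and T: "continuous_on UNIV T"
    and S: "S \<subseteq> invariant_measures T" "S \<noteq> {}"
    and cl: "\<And>\<mu>s \<mu>. (\<And>n. \<mu>s n \<in> S) \<Longrightarrow> \<mu> \<in> borel_probs \<Longrightarrow> weakly_converges \<mu>s \<mu> \<Longrightarrow> \<mu> \<in> S"
    and face: "\<And>\<mu> A. \<mu> \<in> S \<Longrightarrow> A \<in> sets borel \<Longrightarrow> T -` A = A \<Longrightarrow> 0 < measure \<mu> A \<Longrightarrow> measure \<mu> A < 1 \<Longrightarrow>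
       uniform_measure \<mu> A \<in> S"
  shows "\<exists>\<mu>\<in>S. \<mu> \<in> ergodic_measures T"
proof -
  obtain B :: "nat \<Rightarrow> 'a set" where B: "topological_basis (range B)" "\<And>i j. \<exists>k. B i \<inter> B j = B k"
    using compact_metric_countable_basis[OF c] by blast
  \<comment> \<open>All bumps are arranged in one sequence; because their integrals determine a
    measure, the convexity of \<Phi> is strict.\<close>
  define h where "h k = (case prod_decode k of (i, j) \<Rightarrow> bump (B i) j)" for k
  have hc: "continuous_on UNIV (h k)" for k unfolding h_def by (simp add: continuous_bump split: prod.split)
  have hb: "0 \<le> h k x" "h k x \<le> 1" for k x unfolding h_def by (auto simp: bump_bounds split: prod.split)
  have Sb: "\<mu> \<in> borel_probs" if "\<mu> \<in> S" for \<mu> using that S(1) invariant_measures_probs by blast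
  have I: "0 \<le> (\<integral>x. h k x \<partial>\<mu>)" "(\<integral>x. h k x \<partial>\<mu>) \<le> 1" if "\<mu> \<in> borel_probs" for k \<mu>
  proof -
    interpret prob_space \<mu> using that by (simp add: borel_probs_def)
    have "integrable \<mu> (h k)"
      using that by (intro integrable_continuous_compact c hc) (auto simp: borel_probs_def prob_space.finite_measure)
    then show "(\<integral>x. h k x \<partial>\<mu>) \<le> 1"
      using integral_mono[of \<mu> "h k" "\<lambda>_. 1"] hb by (simp add: prob_space)
    show "0 \<le> (\<integral>x. h k x \<partial>\<mu>)" using hb by simp
  qed
  have sg: "summable (\<lambda>k. (1/2) ^ k :: real)" by (simp add: summable_geometric)
  have bd: "norm ((1/2) ^ k * (\<integral>x. h k x \<partial>\<mu>)\<^sup>2) \<le> (1/2) ^ k" if "\<mu> \<in> borel_probs" for k \<mu>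
    using I[OF that, of k] by (simp add: abs_mult power_le_one mult_left_le)
  have sm: "summable (\<lambda>k. (1/2) ^ k * (\<integral>x. h k x \<partial>\<mu>)\<^sup>2)" if "\<mu> \<in> borel_probs" for \<mu>
    by (rule summable_comparison_test'[OF sg, of 0]) (rule bd[OF that])
  \<comment> \<open>Each integral lies in [0,1], so the weights \<open>(1/2) ^ k\<close> dominate
    the series uniformly over all measures, and Tannery's theorem makes \<Phi> weakly
    continuous.\<close>
  define \<Phi> where "\<Phi> \<mu> = (\<Sum>k. (1/2) ^ k * (\<integral>x. h k x \<partial>\<mu>)\<^sup>2)" for \<mu>
  have lim: "(\<lambda>n. \<Phi> (\<mu>s n)) \<longlonglongrightarrow> \<Phi> \<mu>"
    if "\<And>n. \<mu>s n \<in> borel_probs" "\<mu> \<in> borel_probs" "weakly_converges \<mu>s \<mu>" for \<mu>s \<mu>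
  proof -
    have "((\<lambda>n. \<Sum>k. (1/2) ^ k * (\<integral>x. h k x \<partial>\<mu>s n)\<^sup>2) \<longlongrightarrow> (\<Sum>k. (1/2) ^ k * (\<integral>x. h k x \<partial>\<mu>)\<^sup>2)) sequentially"
    proof (rule tannerys_theorem[THEN conjunct2, THEN conjunct2])
      show "(\<lambda>n. (1/2) ^ k * (\<integral>x. h k x \<partial>\<mu>s n)\<^sup>2) \<longlonglongrightarrow> (1/2) ^ k * (\<integral>x. h k x \<partial>\<mu>)\<^sup>2" for k
        using that(3) hc by (intro tendsto_intros) (simp add: weakly_converges_def)
      show "eventually (\<lambda>(k, n). norm ((1/2) ^ k * (\<integral>x. h k x \<partial>\<mu>s n)\<^sup>2) \<le> (1/2) ^ k) (at_top \<times>\<^sub>F sequentially)"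
        using bd[OF that(1)] by (intro always_eventually) auto
    qed (use sg in auto)
    then show ?thesis by (simp add: \<Phi>_def)
  qed
  have "\<exists>\<mu>\<in>S. \<forall>\<nu>\<in>S. ereal (\<Phi> \<nu>) \<le> ereal (\<Phi> \<mu>)"
  proof (rule weakly_closed_attains_max[OF c _ S(2) cl])
    show "S \<subseteq> borel_probs" using Sb by blast
    fix \<mu>s \<mu> and f :: "nat \<Rightarrow> ereal" and l
    assume a: "\<And>n. \<mu>s n \<in> S" "\<mu> \<in> S" "weakly_converges \<mu>s \<mu>" "f \<longlonglongrightarrow> l" "\<And>n. f n \<le> ereal (\<Phi> (\<mu>s n))"
    have "(\<lambda>n. ereal (\<Phi> (\<mu>s n))) \<longlonglongrightarrow> ereal (\<Phi> \<mu>)"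
      using lim[of \<mu>s \<mu>] a(1-3) Sb by simp
    then show "l \<le> ereal (\<Phi> \<mu>)" using LIMSEQ_le[OF a(4)] a(5) by blast
  qed
  then obtain \<mu> where \<mu>: "\<mu> \<in> S" and max: "\<And>\<nu>. \<nu> \<in> S \<Longrightarrow> \<Phi> \<nu> \<le> \<Phi> \<mu>" by auto
  have inv: "\<mu> \<in> invariant_measures T" using \<mu> S by blast
  have \<mu>b: "\<mu> \<in> borel_probs" and s: "sets \<mu> = sets borel" and ps: "prob_space \<mu>"
    using Sb[OF \<mu>] by (auto simp: borel_probs_def)
  interpret prob_space \<mu> by fact
  have sp: "space \<mu> = UNIV" using s by (auto dest: sets_eq_imp_space_eq)
  have "emeasure \<mu> A = 0 \<or> emeasure \<mu> A = 1" if A: "A \<in> sets borel" "T -` A = A" for A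
  proof (rule ccontr)
    assume "\<not> ?thesis"
    then have t: "0 < measure \<mu> A" "measure \<mu> A < 1"
      using prob_le_1[of A] measure_nonneg[of \<mu> A] by (auto simp: emeasure_eq_measure less_le)
    have cA: "measure \<mu> (- A) = 1 - measure \<mu> A"
      using prob_compl[of A] A s sp by (simp add: Compl_eq_Diff_UNIV)
    define t where "t = measure \<mu> A"
    have t01: "0 < t" "t < 1" using t by (auto simp: t_def)
    define \<mu>1 \<mu>2 where "\<mu>1 = uniform_measure \<mu> A" and "\<mu>2 = uniform_measure \<mu> (- A)"
    have S1: "\<mu>1 \<in> S" unfolding \<mu>1_def by (intro face \<mu> A t)
    have S2: "\<mu>2 \<in> S" unfolding \<mu>2_def using A t cA by (intro face \<mu>) auto
    define a b where "a k = (\<integral>x. h k x \<partial>\<mu>1)" and "b k = (\<integral>x. h k x \<partial>\<mu>2)" for k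
    have eq: "(\<integral>x. h k x \<partial>\<mu>) = t * a k + (1 - t) * b k" for k
      unfolding a_def b_def \<mu>1_def \<mu>2_def t_def by (rule integral_uniform_measure_split[OF c \<mu>b A(1) t hc])
    \<comment> \<open>The exact convexity gap of the square: the weighted mean of the squares
      exceeds the square of the weighted mean by \<open>t * (1 - t)\<close> times the squared
      difference.\<close>
    have sq: "(1/2) ^ k * (\<integral>x. h k x \<partial>\<mu>)\<^sup>2 + t * (1 - t) * ((1/2) ^ k * (a k - b k)\<^sup>2) =
        t * ((1/2) ^ k * (a k)\<^sup>2) + (1 - t) * ((1/2) ^ k * (b k)\<^sup>2)" for k
      unfolding eq by (simp add: power2_eq_square algebra_simps)
    have sa: "summable (\<lambda>k. (1/2) ^ k * (a k)\<^sup>2)" and sb: "summable (\<lambda>k. (1/2) ^ k * (b k)\<^sup>2)"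
      unfolding a_def b_def using sm Sb S1 S2 by auto
    have sR: "summable (\<lambda>k. t * ((1/2) ^ k * (a k)\<^sup>2) + (1 - t) * ((1/2) ^ k * (b k)\<^sup>2))"
      using sa sb by (intro summable_add summable_mult)
    have "summable (\<lambda>k. ((1/2) ^ k * (\<integral>x. h k x \<partial>\<mu>)\<^sup>2 + t * (1 - t) * ((1/2) ^ k * (a k - b k)\<^sup>2)) -
        (1/2) ^ k * (\<integral>x. h k x \<partial>\<mu>)\<^sup>2)"
      unfolding sq using sR sm[OF \<mu>b] by (rule summable_diff)
    then have sd: "summable (\<lambda>k. t * (1 - t) * ((1/2) ^ k * (a k - b k)\<^sup>2))" by simp
    have "\<Phi> \<mu> + (\<Sum>k. t * (1 - t) * ((1/2) ^ k * (a k - b k)\<^sup>2)) = t * \<Phi> \<mu>1 + (1 - t) * \<Phi> \<mu>2"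
      unfolding \<Phi>_def suminf_add[OF sm[OF \<mu>b] sd] sq a_def[symmetric] b_def[symmetric]
      by (subst suminf_add[symmetric]) (use sa sb in \<open>auto intro: summable_mult simp: suminf_mult\<close>)
    also have "\<dots> \<le> t * \<Phi> \<mu> + (1 - t) * \<Phi> \<mu>"
      using max[OF S1] max[OF S2] t01 by (intro add_mono mult_left_mono) auto
    also have "\<dots> = \<Phi> \<mu>" by (simp add: algebra_simps)
    finally have le: "(\<Sum>k. t * (1 - t) * ((1/2) ^ k * (a k - b k)\<^sup>2)) \<le> 0" by simp
    have nn: "0 \<le> t * (1 - t) * ((1/2) ^ k * (a k - b k)\<^sup>2)" for k using t01 by simp
    have "(\<Sum>k. t * (1 - t) * ((1/2) ^ k * (a k - b k)\<^sup>2)) = 0"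
      using le suminf_nonneg[OF sd nn] by simp
    then have "t * (1 - t) * ((1/2) ^ k * (a k - b k)\<^sup>2) = 0" for k
      using suminf_eq_zero_iff[OF sd nn] by blast
    then have ab: "a k = b k" for k using t01 by simp
    \<comment> \<open>At a maximiser the gap has to vanish for every bump, so the two conditional
      measures coincide, although one gives \<open>A\<close> mass 1 and the other mass 0.\<close>
    have "\<mu>1 = \<mu>2"
    proof (rule borel_probs_eqI[OF c Sb[OF S1] Sb[OF S2] B])
      fix i j show "(\<integral>x. bump (B i) j x \<partial>\<mu>1) = (\<integral>x. bump (B i) j x \<partial>\<mu>2)"
        using ab[of "prod_encode (i, j)"] by (simp add: a_def b_def h_def)
    qed
    moreover have "emeasure \<mu>1 A = 1" unfolding \<mu>1_def
      using A t by (intro emeasure_uniform_measure_1) (auto simp: emeasure_eq_measure)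
    moreover have "emeasure \<mu>2 A = 0" unfolding \<mu>2_def using A s by simp
    ultimately show False by simp
  qed
  then have "\<mu> \<in> ergodic_measures T" using inv by (simp add: ergodic_measures_def)
  then show ?thesis using \<mu> by (rule bexI)
qed

section \<open>Means of a subadditive sequence under an invariant measure\<close>

lemma ext_integral_const:
  assumes "prob_space M" "c \<noteq> \<infinity>"
  shows "ext_integral M (\<lambda>_. c) = c"
proof -
  interpret prob_space M by fact
  show ?thesis
  proof (cases c)
    case (real r)
    then show ?thesis using ext_integral_eq_integral[of M "\<lambda>_. r"] by (simp add: prob_space)
  next
    case MInf
    then show ?thesis unfolding ext_integral_def by (simp add: e2ennreal_neg emeasure_space_1 zero_ennreal.rep_eq)
  qed (use assms in simp)
qed

lemma ext_integral_le_max: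
  assumes "prob_space M" "\<And>y. f y \<le> f x" "f x \<noteq> \<infinity>"
  shows "ext_integral M f \<le> f x"
proof -
  have "ext_integral M f \<le> ext_integral M (\<lambda>_. f x)" using assms(2) by (rule ext_integral_mono)
  also have "\<dots> = f x" using assms(1,3) by (rule ext_integral_const)
  finally show ?thesis .
qed

text \<open>Invariance of \<mu> removes the shift by \<open>T ^^ k\<close>, and upper bounds let the
  integral of the sum split. The growth rate under \<mu> thereby becomes a numerical Fekete
  limit.\<close>

lemma ext_integral_subadditive:
  fixes T :: "'a::topological_space \<Rightarrow> 'a"
  assumes c: "compact (UNIV :: 'a set)" and T: "continuous_on UNIV T"
    and usc: "\<And>n. n \<ge> 1 \<Longrightarrow> upper_semicontinuous (f n)"
    and fin: "\<And>n x. n \<ge> 1 \<Longrightarrow> f n x \<noteq> \<infinity>"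
    and sub: "subadditive_sequence T f"
    and m: "\<mu> \<in> invariant_measures T" and n: "1 \<le> n" "1 \<le> k"
  shows "ext_integral \<mu> (f (n + k)) \<le> ext_integral \<mu> (f n) + ext_integral \<mu> (f k)"
proof -
  have ps: "prob_space \<mu>" and s: "sets \<mu> = sets borel" using m by (auto simp: invariant_measures_def)
  obtain b where b: "0 \<le> b" "\<And>x. f n x \<le> ereal b" using usc_bounded_above[OF c usc[OF n(1)] fin[OF n(1)]] by blast
  obtain d where d: "0 \<le> d" "\<And>x. f k x \<le> ereal d" using usc_bounded_above[OF c usc[OF n(2)] fin[OF n(2)]] by blast
  have fm: "f j \<in> borel_measurable borel" if "1 \<le> j" for j using usc_borel_measurable[OF usc[OF that]] .
  have Tk: "(T ^^ k) \<in> measurable borel borel"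
  proof (induction k)
    case (Suc k)
    then show ?case
      using measurable_compose[OF Suc borel_measurable_continuous_onI[OF T]] by (simp add: comp_def)
  qed (simp add: id_def)
  have "ext_integral \<mu> (f (n + k)) \<le> ext_integral \<mu> (\<lambda>x. f n ((T ^^ k) x) + f k x)"
    using sub n unfolding subadditive_sequence_def by (intro ext_integral_mono) auto
  also have "\<dots> = ext_integral \<mu> (\<lambda>x. f n ((T ^^ k) x)) + ext_integral \<mu> (f k)"
    using fm[OF n(2)] measurable_compose[OF Tk fm[OF n(1)]] b d
    by (intro ext_integral_add[OF ps _ _ b(1) _ d(1)]) (auto simp: measurable_cong_sets[OF s refl])
  also have "ext_integral \<mu> (\<lambda>x. f n ((T ^^ k) x)) = ext_integral \<mu> (f n)"
  proof -
    have "ext_integral \<mu> (\<lambda>x. g ((T ^^ k) x)) = ext_integral \<mu> g" if "g \<in> borel_measurable borel" for g :: "'a \<Rightarrow> ereal"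
      using that
    proof (induction k arbitrary: g)
      case (Suc k)
      have "(\<lambda>x. g (T x)) \<in> borel_measurable borel"
        using measurable_compose[OF borel_measurable_continuous_onI[OF T] Suc.prems] .
      from Suc.IH[OF this] show ?case using ext_integral_invariant[OF T m Suc.prems] by simp
    qed simp
    then show ?thesis using fm[OF n(1)] by blast
  qed
  finally show ?thesis .
qed

section \<open>The subadditive variational principle\<close>

text \<open>A growth rate below \<gamma> under the conditional measure would have to be compensated
  on the complement, but there the mean of \<open>f k / k\<close> is at most \<open>u k\<close>,
  which tends to \<gamma>; for large \<open>k\<close> the total would drop below \<gamma>. So the
  limit of the conditional means is at least \<gamma>. By Fekete's lemma this limit is their
  infimum, which gives the bound at the particular \<open>n\<close>.\<close>

lemma uniform_measure_maximal_growth: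
  fixes T :: "'a::metric_space \<Rightarrow> 'a"
  assumes c: "compact (UNIV :: 'a set)" and T: "continuous_on UNIV T"
    and usc: "\<And>n. n \<ge> 1 \<Longrightarrow> upper_semicontinuous (f n)"
    and fin: "\<And>n x. n \<ge> 1 \<Longrightarrow> f n x \<noteq> \<infinity>"
    and sub: "subadditive_sequence T f"
    and u: "u \<longlonglongrightarrow> ereal \<gamma>" "\<And>n x. n \<ge> 1 \<Longrightarrow> f n x / ereal (real n) \<le> u n"
    and m: "\<mu> \<in> invariant_measures T" and gr: "\<And>n. n \<ge> 1 \<Longrightarrow> ereal (real n * \<gamma>) \<le> ext_integral \<mu> (f n)"
    and A: "A \<in> sets borel" "T -` A = A" "0 < measure \<mu> A" "measure \<mu> A < 1"
    and n: "n \<ge> 1"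
  shows "ereal (real n * \<gamma>) \<le> ext_integral (uniform_measure \<mu> A) (f n)"
proof -
  have s: "sets \<mu> = sets borel" and ps: "prob_space \<mu>" using m by (auto simp: invariant_measures_def)
  interpret prob_space \<mu> by fact
  have sp: "space \<mu> = UNIV" using s by (auto dest: sets_eq_imp_space_eq)
  define t where "t = measure \<mu> A"
  have t: "0 < t" "t < 1" using A by (auto simp: t_def)
  define \<mu>1 \<mu>2 where "\<mu>1 = uniform_measure \<mu> A" and "\<mu>2 = uniform_measure \<mu> (space \<mu> - A)"
  have i1: "\<mu>1 \<in> invariant_measures T" unfolding \<mu>1_def using m A(1-3) T by (rule uniform_measure_invariant)
  then have p1: "prob_space \<mu>1" by (simp add: invariant_measures_def)
  have "measure \<mu> (space \<mu> - A) = 1 - t" unfolding t_def using prob_compl[of A] A s by simp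
  then have p2: "prob_space \<mu>2" unfolding \<mu>2_def
    using t by (intro prob_space_uniform_measure) (auto simp: emeasure_eq_measure)
  have split: "ext_integral \<mu> (f k) = ereal t * ext_integral \<mu>1 (f k) + ereal (1 - t) * ext_integral \<mu>2 (f k)"
    if k: "k \<ge> 1" for k
  proof -
    obtain b where b: "0 \<le> b" "\<And>x. f k x \<le> ereal b" using usc_bounded_above[OF c usc[OF k] fin[OF k]] by blast
    show ?thesis unfolding \<mu>1_def \<mu>2_def t_def
      using usc_borel_measurable[OF usc[OF k]] A s
      by (intro ext_integral_uniform_measure_split[OF ps _ _ _ _ b]) (auto simp: measurable_cong_sets[OF s refl])
  qed
  let ?a = "\<lambda>k. ext_integral \<mu>1 (f k)"
  have max: "ext_integral \<nu> (f k) \<noteq> \<infinity>" if \<nu>: "prob_space \<nu>" and k: "k \<ge> 1" for \<nu> k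
  proof -
    obtain x where x: "\<And>y. f k y \<le> f k x" using usc_attains_max[OF c usc[OF k]] by blast
    show ?thesis using ext_integral_le_max[where f = "f k" and x = x, OF \<nu> x fin[OF k]] fin[OF k, of x] by auto
  qed
  have lim: "(\<lambda>k. ?a k / ereal (real k)) \<longlonglongrightarrow> (INF k\<in>{1..}. ?a k / ereal (real k))"
    by (rule ereal_subadditive_tendsto)
       (use ext_integral_subadditive[OF c T usc fin sub i1] max[OF p1] in auto)
  have "ereal \<gamma> \<le> (INF k\<in>{1..}. ?a k / ereal (real k))"
  proof (rule ccontr)
    assume "\<not> ?thesis"
    then have "(INF k\<in>{1..}. ?a k / ereal (real k)) < ereal \<gamma>" by (simp only: not_le)
    from ereal_dense2[OF this]
    obtain d where d: "(INF k\<in>{1..}. ?a k / ereal (real k)) < ereal d" "ereal d < ereal \<gamma>" by blast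
    \<comment> \<open>The deficit \<open>t * (\<gamma> - d)\<close> on \<open>A\<close> is then
      \<open>2 * e\<close>, whereas the complement gains at most \<open>(1 - t) * e\<close>.\<close>
    define e where "e = t * (\<gamma> - d) / 2"
    have e: "e > 0" using t d by (simp add: e_def)
    have "eventually (\<lambda>k. ?a k / ereal (real k) < ereal d) sequentially"
      using order_tendstoD(2)[OF lim d(1)] .
    moreover have "eventually (\<lambda>k. u k < ereal (\<gamma> + e)) sequentially"
      using order_tendstoD(2)[OF u(1), of "ereal (\<gamma> + e)"] e by simp
    moreover have "eventually (\<lambda>k::nat. k \<ge> 1) sequentially" by (rule eventually_ge_at_top)
    ultimately have "eventually (\<lambda>k. False) sequentially"
    proof eventually_elim
      case (elim k)
      have 1: "?a k \<le> ereal (real k * d)"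
        using elim(1,3) by (simp flip: ereal_div_nat_le_iff)
      have 2: "ext_integral \<mu>2 (f k) \<le> ereal (real k * (\<gamma> + e))"
      proof -
        have "f k x / ereal (real k) \<le> ereal (\<gamma> + e)" for x
          using u(2)[OF elim(3), of x] elim(2) by (meson le_less_trans less_imp_le)
        then have "f k x \<le> ereal (real k * (\<gamma> + e))" for x
          using ereal_div_nat_le_iff[OF elim(3)] by blast
        then have "ext_integral \<mu>2 (f k) \<le> ext_integral \<mu>2 (\<lambda>_. ereal (real k * (\<gamma> + e)))"
          by (rule ext_integral_mono)
        then show ?thesis using ext_integral_const[OF p2, of "ereal (real k * (\<gamma> + e))"] by simp
      qed
      have "ereal (real k * \<gamma>) \<le> ereal t * ?a k + ereal (1 - t) * ext_integral \<mu>2 (f k)"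
        using gr[OF elim(3)] split[OF elim(3)] by simp
      also have "\<dots> \<le> ereal t * ereal (real k * d) + ereal (1 - t) * ereal (real k * (\<gamma> + e))"
        using 1 2 t by (intro add_mono ereal_mult_left_mono) auto
      finally have "real k * \<gamma> \<le> real k * (t * d + (1 - t) * (\<gamma> + e))" by (simp add: algebra_simps)
      then have "\<gamma> \<le> t * d + (1 - t) * (\<gamma> + e)" using elim(3) by simp
      also have "\<dots> = \<gamma> - t * (\<gamma> - d) + (1 - t) * e" by (simp add: algebra_simps)
      also have "\<dots> = \<gamma> - 2 * e + (1 - t) * e" by (simp add: e_def)
      also have "\<dots> < \<gamma>"
      proof -
        have "(1 - t) * e < 2 * e" using e t by (intro mult_strict_right_mono) auto
        then show ?thesis by simp
      qed
      finally show ?case by simp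
    qed
    then show False by simp
  qed
  then have "ereal \<gamma> \<le> ?a n / ereal (real n)"
    using n by (meson INF_lower atLeast_iff order_trans)
  then show ?thesis using ereal_le_div_nat_iff[OF n] by (simp add: \<mu>1_def)
qed

lemma exists_ergodic_measure_of_maximal_growth:
  fixes T :: "'a::metric_space \<Rightarrow> 'a"
  assumes c: "compact (UNIV :: 'a set)" and T: "continuous_on UNIV T"
    and usc: "\<And>n. n \<ge> 1 \<Longrightarrow> upper_semicontinuous (f n)"
    and fin: "\<And>n x. n \<ge> 1 \<Longrightarrow> f n x \<noteq> \<infinity>"
    and sub: "subadditive_sequence T f"
    and u: "u \<longlonglongrightarrow> ereal \<gamma>" "\<And>n x. n \<ge> 1 \<Longrightarrow> f n x / ereal (real n) \<le> u n"
    and x: "\<And>n. n \<ge> 1 \<Longrightarrow> ereal (real n * \<gamma>) \<le> f n x"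
  shows "\<exists>\<mu>\<in>ergodic_measures T. \<forall>n\<ge>1. ereal (real n * \<gamma>) \<le> ext_integral \<mu> (f n)"
proof -
  define S where "S = {\<mu> \<in> invariant_measures T. \<forall>n\<ge>1. ereal (real n * \<gamma>) \<le> ext_integral \<mu> (f n)}"
  have "\<exists>\<mu>\<in>S. \<mu> \<in> ergodic_measures T"
  proof (rule exists_ergodic_in_face[OF c T])
    show "S \<subseteq> invariant_measures T" by (auto simp: S_def)
    show "S \<noteq> {}" using orbit_measure_of_maximal_growth[OF c T usc fin sub x] by (auto simp: S_def)
  next
    fix \<mu>s \<mu> assume a: "\<And>n. \<mu>s n \<in> S" "\<mu> \<in> borel_probs" "weakly_converges \<mu>s \<mu>"
    have i: "\<mu>s n \<in> invariant_measures T" for n using a(1) by (simp add: S_def)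
    have "\<mu> \<in> invariant_measures T" using invariant_measures_weakly_closed[OF c T i a(2,3)] .
    moreover have "ereal (real n * \<gamma>) \<le> ext_integral \<mu> (f n)" if n: "n \<ge> 1" for n
      by (rule weakly_converges_ext_integral_ge[OF c usc[OF n] fin[OF n] invariant_measures_probs[OF i] a(2,3) tendsto_const])
         (use a(1) n in \<open>simp add: S_def\<close>)
    ultimately show "\<mu> \<in> S" by (simp add: S_def)
  next
    fix \<mu> A assume a: "\<mu> \<in> S" "A \<in> sets borel" "T -` A = A" "0 < measure \<mu> A" "measure \<mu> A < 1"
    have m: "\<mu> \<in> invariant_measures T" and gr: "\<And>n. n \<ge> 1 \<Longrightarrow> ereal (real n * \<gamma>) \<le> ext_integral \<mu> (f n)"
      using a(1) by (auto simp: S_def)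
    show "uniform_measure \<mu> A \<in> S"
      using uniform_measure_invariant[OF m a(2,3,4) T]
        uniform_measure_maximal_growth[OF c T usc fin sub u m gr a(2-5)]
      by (simp add: S_def)
  qed
  then show ?thesis by (auto simp: S_def)
qed

text \<open>For growth -\<infinity> no lower bound singles out a face, so the set of all invariant
  measures is taken as one.\<close>

lemma exists_ergodic_measure:
  fixes T :: "'a::metric_space \<Rightarrow> 'a"
  assumes c: "compact (UNIV :: 'a set)" and T: "continuous_on UNIV T"
  shows "\<exists>\<mu>. \<mu> \<in> ergodic_measures T"
proof -
  have "\<exists>\<mu>\<in>invariant_measures T. \<mu> \<in> ergodic_measures T"
    by (rule exists_ergodic_in_face[OF c T])
       (use empirical_measure_subsequence[OF c T] invariant_measures_weakly_closed[OF c T]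
          uniform_measure_invariant T in blast)+
  then show ?thesis by blast
qed

text \<open>The space is a whole type, so nonemptiness is built in. Limits inside a supremum are
  stated as \<open>convergent\<close> together with \<open>lim\<close>, because \<open>lim\<close>
  alone has an unspecified value for a divergent sequence.\<close>

theorem theoremA3:
  fixes T :: "'a::metric_space \<Rightarrow> 'a" and f :: "nat \<Rightarrow> 'a \<Rightarrow> ereal"
  assumes compact: "compact (UNIV :: 'a set)"
    and cont: "continuous_on UNIV T"
    and usc: "\<And>n. n \<ge> 1 \<Longrightarrow> upper_semicontinuous (f n)"
    and not_PInf: "\<And>n x. n \<ge> 1 \<Longrightarrow> f n x \<noteq> \<infinity>"
    and subadd: "subadditive_sequence T f"
  shows
    "(max_growth T f =
       (SUP \<mu>\<in>ergodic_measures T. INF n\<in>{1..}. ext_integral \<mu> (f n) / ereal (real n))) \<and>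
     (max_growth T f = (INF n\<in>{1..}. SUP x. f n x / ereal (real n))) \<and>
     (max_growth T f =
       (INF n\<in>{1..}. SUP \<mu>\<in>invariant_measures T. ext_integral \<mu> (f n) / ereal (real n))) \<and>
     (max_growth T f = (SUP x. INF n\<in>{1..}. f n x / ereal (real n))) \<and>
     (\<forall>\<mu>\<in>invariant_measures T. convergent (\<lambda>n. ext_integral \<mu> (f n) / ereal (real n))) \<and>
     ((SUP \<mu>\<in>invariant_measures T. lim (\<lambda>n. ext_integral \<mu> (f n) / ereal (real n)))
       = max_growth T f) \<and>
     (\<forall>\<mu>\<in>ergodic_measures T. convergent (\<lambda>n. ext_integral \<mu> (f n) / ereal (real n))) \<and>
     ((SUP \<mu>\<in>ergodic_measures T. lim (\<lambda>n. ext_integral \<mu> (f n) / ereal (real n)))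
       = max_growth T f) \<and>
     ((\<lambda>n. SUP x. f n x / ereal (real n)) \<longlonglongrightarrow> max_growth T f) \<and>
     ((\<lambda>n. SUP \<mu>\<in>invariant_measures T. ext_integral \<mu> (f n) / ereal (real n))
       \<longlonglongrightarrow> max_growth T f) \<and>
     (\<exists>\<mu>\<in>invariant_measures T. (INF n\<in>{1..}. ext_integral \<mu> (f n) / ereal (real n))
       = (SUP \<nu>\<in>invariant_measures T. INF n\<in>{1..}. ext_integral \<nu> (f n) / ereal (real n))) \<and>
     (\<exists>\<mu>\<in>ergodic_measures T. (INF n\<in>{1..}. ext_integral \<mu> (f n) / ereal (real n))
       = (SUP \<nu>\<in>ergodic_measures T. INF n\<in>{1..}. ext_integral \<nu> (f n) / ereal (real n))) \<and>
     (\<exists>x. (INF n\<in>{1..}. f n x / ereal (real n)) = (SUP y. INF n\<in>{1..}. f n y / ereal (real n))) \<and>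
     (\<forall>n\<ge>1. \<exists>x. f n x / ereal (real n) = (SUP y. f n y / ereal (real n))) \<and>
     (\<forall>n\<ge>1. \<exists>\<mu>\<in>invariant_measures T. ext_integral \<mu> (f n) / ereal (real n)
       = (SUP \<nu>\<in>invariant_measures T. ext_integral \<nu> (f n) / ereal (real n)))"
proof -
  let ?I = "invariant_measures T" and ?E = "ergodic_measures T"
  define a where "a \<mu> n = ext_integral \<mu> (f n) / ereal (real n)" for \<mu> n
  define u where "u n = (SUP x. f n x / ereal (real n))" for n
  define v where "v n = (SUP \<mu>\<in>?I. a \<mu> n)" for n
  define \<gamma> where "\<gamma> = (INF n\<in>{1..}. u n)"
  have EI: "?E \<subseteq> ?I" by (auto simp: ergodic_measures_def)
  have psI: "prob_space \<mu>" if "\<mu> \<in> ?I" for \<mu> using that by (simp add: invariant_measures_def)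
  have div: "x / ereal (real n) \<le> y / ereal (real n)" if "x \<le> y" "n \<ge> 1" for x y :: ereal and n :: nat
    using that by (intro ereal_divide_right_mono) auto
  have "\<forall>n. \<exists>x. n \<ge> 1 \<longrightarrow> (\<forall>y. f n y \<le> f n x)" using usc_attains_max[OF compact usc] by blast
  then obtain X where X: "\<And>n y. n \<ge> 1 \<Longrightarrow> f n y \<le> f n (X n)" by metis
  have uX: "u n = f n (X n) / ereal (real n)" if "n \<ge> 1" for n
    unfolding u_def using that X div by (intro antisym SUP_least SUP_upper) auto
  have fu: "f n x / ereal (real n) \<le> u n" for n x unfolding u_def by (rule SUP_upper) simp
  have au: "a \<mu> n \<le> u n" if "\<mu> \<in> ?I" "n \<ge> 1" for \<mu> n
    unfolding a_def uX[OF that(2)] using that X not_PInf by (intro div ext_integral_le_max psI) auto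
  have efin: "ext_integral \<mu> (f n) \<noteq> \<infinity>" if "\<mu> \<in> ?I" "n \<ge> 1" for \<mu> n
    using ext_integral_le_max[OF psI[OF that(1)], of "f n" "X n"] X not_PInf that(2) by fastforce
  have esub: "ext_integral \<mu> (f (n + m)) \<le> ext_integral \<mu> (f n) + ext_integral \<mu> (f m)"
    if "\<mu> \<in> ?I" "n \<ge> 1" "m \<ge> 1" for \<mu> n m
    using ext_integral_subadditive[OF compact cont usc not_PInf subadd that] .
  have alim: "a \<mu> \<longlonglongrightarrow> (INF n\<in>{1..}. a \<mu> n)" if "\<mu> \<in> ?I" for \<mu>
    unfolding a_def using esub efin that by (intro ereal_subadditive_tendsto) auto
  have ulim: "u \<longlonglongrightarrow> \<gamma>"
  proof -
    have "(\<lambda>n. f n (X n) / ereal (real n)) \<longlonglongrightarrow> (INF n\<in>{1..}. f n (X n) / ereal (real n))"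
    proof (rule ereal_subadditive_tendsto)
      fix n m :: nat assume nm: "1 \<le> n" "1 \<le> m"
      let ?x = "X (n + m)"
      have "f (n + m) ?x \<le> f n ((T ^^ m) ?x) + f m ?x"
        using subadd nm by (simp add: subadditive_sequence_def)
      also have "\<dots> \<le> f n (X n) + f m (X m)" by (intro add_mono X nm)
      finally show "f (n + m) ?x \<le> f n (X n) + f m (X m)" .
    qed (use not_PInf in simp)
    also have "(INF n\<in>{1..}. f n (X n) / ereal (real n)) = \<gamma>"
      unfolding \<gamma>_def by (rule INF_cong) (auto simp: uX)
    \<comment> \<open>\<open>X 0\<close> is not chosen as a maximiser, so the two sequences are only
      known to agree from index 1 on.\<close>
    finally show ?thesis
    proof (rule Lim_transform_eventually)
      show "eventually (\<lambda>n. f n (X n) / ereal (real n) = u n) sequentially"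
        using eventually_ge_at_top[of 1] by eventually_elim (simp add: uX)
    qed
  qed
  \<comment> \<open>One ergodic measure and one point meet all lower bounds at once. With the upper
    bounds by \<open>u\<close>, this pair determines the three suprema of infima over
    \<open>n\<close> and shows that they are attained.\<close>
  have key: "\<exists>\<mu>0 x0. \<mu>0 \<in> ?E \<and> (\<forall>n\<ge>1. \<gamma> \<le> a \<mu>0 n \<and> \<gamma> \<le> f n x0 / ereal (real n))"
  proof (cases \<gamma>)
    case (real g)
    have ug: "ereal g \<le> (SUP x. f n x / ereal (real n))" if "n \<ge> 1" for n
      unfolding real[symmetric] \<gamma>_def u_def[symmetric] using that by (intro INF_lower) simp
    obtain x where x: "\<And>n. n \<ge> 1 \<Longrightarrow> ereal (real n * g) \<le> f n x"
      using exists_point_of_maximal_growth[OF compact usc not_PInf subadd ug] by blast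
    obtain \<mu> where \<mu>: "\<mu> \<in> ?E" "\<And>n. n \<ge> 1 \<Longrightarrow> ereal (real n * g) \<le> ext_integral \<mu> (f n)"
      using exists_ergodic_measure_of_maximal_growth
        [OF compact cont usc not_PInf subadd ulim[unfolded real] fu x] by blast
    show ?thesis using x \<mu> by (intro exI[of _ \<mu>] exI[of _ x]) (simp add: real a_def ereal_le_div_nat_iff)
  next
    case PInf
    have "\<gamma> \<le> u 1" unfolding \<gamma>_def by (rule INF_lower) simp
    then show ?thesis using PInf uX[of 1] not_PInf[of 1 "X 1"] by (simp add: one_ereal_def[symmetric])
  next
    \<comment> \<open>The lower bounds are void here, but an ergodic measure must still exist for
      its supremum to be attained.\<close>
    case MInf
    then show ?thesis using exists_ergodic_measure[OF compact cont] by auto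
  qed
  then obtain \<mu>0 x0 where \<mu>0: "\<mu>0 \<in> ?E" "\<And>n. n \<ge> 1 \<Longrightarrow> \<gamma> \<le> a \<mu>0 n"
    and x0: "\<And>n. n \<ge> 1 \<Longrightarrow> \<gamma> \<le> f n x0 / ereal (real n)" by blast
  have \<mu>0I: "\<mu>0 \<in> ?I" using \<mu>0(1) EI by blast
  define A where "A \<mu> = (INF n\<in>{1..}. a \<mu> n)" for \<mu>
  define Y where "Y x = (INF n\<in>{1..}. f n x / ereal (real n))" for x
  have A_le: "A \<mu> \<le> \<gamma>" if "\<mu> \<in> ?I" for \<mu>
    unfolding A_def \<gamma>_def using au[OF that] by (intro INF_mono) auto
  have Y_le: "Y x \<le> \<gamma>" for x unfolding Y_def \<gamma>_def using fu by (intro INF_mono) auto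
  have A0: "A \<mu>0 = \<gamma>" using \<mu>0(2) by (intro antisym A_le \<mu>0I) (auto simp: A_def intro: INF_greatest)
  have Y0: "Y x0 = \<gamma>" using x0 by (intro antisym Y_le) (auto simp: Y_def intro: INF_greatest)
  have SI: "(SUP \<mu>\<in>?I. A \<mu>) = \<gamma>" using A_le A0 \<mu>0I by (intro antisym SUP_least) (auto intro: SUP_upper2)
  have SE: "(SUP \<mu>\<in>?E. A \<mu>) = \<gamma>" using A_le A0 \<mu>0 EI by (intro antisym SUP_least) (auto intro: SUP_upper2)
  have SX: "(SUP x. Y x) = \<gamma>" using Y_le Y0 by (intro antisym SUP_least) (auto intro: SUP_upper2)
  have \<beta>: "max_growth T f = \<gamma>" unfolding max_growth_def using SI by (simp add: A_def a_def)
  have vu: "v n \<le> u n" if "n \<ge> 1" for n unfolding v_def using au that by (intro SUP_least)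
  have v\<gamma>: "\<gamma> \<le> v n" if "n \<ge> 1" for n unfolding v_def using \<mu>0(2)[OF that] \<mu>0I by (intro SUP_upper2)
  have vI: "(INF n\<in>{1..}. v n) = \<gamma>"
  proof (rule antisym)
    show "(INF n\<in>{1..}. v n) \<le> \<gamma>" unfolding \<gamma>_def using vu by (intro INF_mono) auto
  qed (use v\<gamma> in \<open>auto intro: INF_greatest\<close>)
  have vlim: "v \<longlonglongrightarrow> \<gamma>"
  proof (rule tendsto_sandwich[OF _ _ tendsto_const ulim])
    show "eventually (\<lambda>n. \<gamma> \<le> v n) sequentially" "eventually (\<lambda>n. v n \<le> u n) sequentially"
      using vu v\<gamma> by (auto simp: eventually_sequentially)
  qed
  \<comment> \<open>Under an invariant measure the limit is the infimum itself, so the suprema of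
    limits and of infima agree term by term.\<close>
  have conv: "convergent (a \<mu>)" "lim (a \<mu>) = A \<mu>" if "\<mu> \<in> ?I" for \<mu>
    using alim[OF that] limI by (auto simp: convergent_def A_def)
  have limSI: "(SUP \<mu>\<in>?I. lim (a \<mu>)) = \<gamma>" using SI conv(2) by (metis (no_types, lifting) SUP_cong)
  have limSE: "(SUP \<mu>\<in>?E. lim (a \<mu>)) = \<gamma>" using SE conv(2) EI by (metis (no_types, lifting) SUP_cong subsetD)
  \<comment> \<open>For a fixed \<open>n\<close> the measure found above need not be a maximiser;
    the direct method is applied to the integral of \<open>f n\<close> itself.\<close>
  have attI: "\<exists>\<mu>\<in>?I. a \<mu> n = v n" if n: "n \<ge> 1" for n
  proof -
    have "\<exists>\<mu>\<in>?I. \<forall>\<nu>\<in>?I. ext_integral \<nu> (f n) \<le> ext_integral \<mu> (f n)"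
    proof (rule weakly_closed_attains_max[OF compact])
      show "?I \<subseteq> borel_probs" using invariant_measures_probs by blast
      show "?I \<noteq> {}" using \<mu>0I by blast
    next
      fix \<mu>s \<mu> assume "\<And>n. \<mu>s n \<in> ?I" "\<mu> \<in> borel_probs" "weakly_converges \<mu>s \<mu>"
      then show "\<mu> \<in> ?I" by (rule invariant_measures_weakly_closed[OF compact cont])
    next
      fix \<mu>s \<mu> h l
      assume s: "\<And>n. \<mu>s n \<in> ?I" "\<mu> \<in> ?I" "weakly_converges \<mu>s \<mu>" "h \<longlonglongrightarrow> l"
        "\<And>i. h i \<le> ext_integral (\<mu>s i) (f n)"
      show "l \<le> ext_integral \<mu> (f n)"
        by (rule weakly_converges_ext_integral_ge[OF compact usc[OF n] not_PInf[OF n]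
              invariant_measures_probs[OF s(1)] invariant_measures_probs[OF s(2)] s(3-5)])
    qed
    then obtain \<mu> where \<mu>: "\<mu> \<in> ?I" "\<And>\<nu>. \<nu> \<in> ?I \<Longrightarrow> ext_integral \<nu> (f n) \<le> ext_integral \<mu> (f n)" by blast
    have "a \<mu> n = v n" unfolding v_def
      using \<mu> div n by (intro antisym SUP_least SUP_upper) (auto simp: a_def)
    then show ?thesis using \<mu>(1) by blast
  qed
  have attX: "\<exists>x. f n x / ereal (real n) = u n" if "n \<ge> 1" for n using uX[OF that] by metis
  note defs = a_def[abs_def] u_def[abs_def] v_def[abs_def] A_def[abs_def] Y_def[abs_def]
  show ?thesis unfolding \<beta>
  proof (intro conjI)
    show "\<gamma> = (SUP \<mu>\<in>?E. INF n\<in>{1..}. ext_integral \<mu> (f n) / ereal (real n))"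
      using SE unfolding defs by simp
    show "\<gamma> = (INF n\<in>{1..}. SUP x. f n x / ereal (real n))" unfolding \<gamma>_def defs ..
    show "\<gamma> = (INF n\<in>{1..}. SUP \<mu>\<in>?I. ext_integral \<mu> (f n) / ereal (real n))"
      using vI unfolding defs by simp
    show "\<gamma> = (SUP x. INF n\<in>{1..}. f n x / ereal (real n))" using SX unfolding defs by simp
    show "\<forall>\<mu>\<in>?I. convergent (\<lambda>n. ext_integral \<mu> (f n) / ereal (real n))"
      using conv(1) unfolding defs by blast
    show "(SUP \<mu>\<in>?I. lim (\<lambda>n. ext_integral \<mu> (f n) / ereal (real n))) = \<gamma>"
      using limSI unfolding defs .
    show "\<forall>\<mu>\<in>?E. convergent (\<lambda>n. ext_integral \<mu> (f n) / ereal (real n))"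
      using conv(1) EI unfolding defs by blast
    show "(SUP \<mu>\<in>?E. lim (\<lambda>n. ext_integral \<mu> (f n) / ereal (real n))) = \<gamma>"
      using limSE unfolding defs .
    show "(\<lambda>n. SUP x. f n x / ereal (real n)) \<longlonglongrightarrow> \<gamma>" using ulim unfolding defs .
    show "(\<lambda>n. SUP \<mu>\<in>?I. ext_integral \<mu> (f n) / ereal (real n)) \<longlonglongrightarrow> \<gamma>"
      using vlim unfolding defs .
    show "\<exists>\<mu>\<in>?I. (INF n\<in>{1..}. ext_integral \<mu> (f n) / ereal (real n))
       = (SUP \<nu>\<in>?I. INF n\<in>{1..}. ext_integral \<nu> (f n) / ereal (real n))"
      using SI A0 \<mu>0I unfolding defs by metis
    show "\<exists>\<mu>\<in>?E. (INF n\<in>{1..}. ext_integral \<mu> (f n) / ereal (real n))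
       = (SUP \<nu>\<in>?E. INF n\<in>{1..}. ext_integral \<nu> (f n) / ereal (real n))"
      using SE A0 \<mu>0(1) unfolding defs by metis
    show "\<exists>x. (INF n\<in>{1..}. f n x / ereal (real n)) = (SUP y. INF n\<in>{1..}. f n y / ereal (real n))"
      using SX Y0 unfolding defs by metis
    show "\<forall>n\<ge>1. \<exists>x. f n x / ereal (real n) = (SUP y. f n y / ereal (real n))"
      using attX unfolding defs by blast
    show "\<forall>n\<ge>1. \<exists>\<mu>\<in>?I. ext_integral \<mu> (f n) / ereal (real n)
       = (SUP \<nu>\<in>?I. ext_integral \<nu> (f n) / ereal (real n))"
      using attI unfolding defs by blast
  qed
qed

end
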